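(* Let $\vec p=(p_1,\infty)$ with $1<p_1<\infty$, and let $\vec a,\vec b,\vec c\in\mathbb{R}^2$, $\vec\alpha\in(-1,\infty)^2$. Then the following are equivalent: (1) $S_{\vec a,\vec b,\vec c}$ is bounded from $L^{\vec p}_{\vec\alpha}(T_B\times T_B)$ to $L^\infty(T_B\times T_B)$; (2) $T_{\vec a,\vec b,\vec c}$ is bounded from $L^{\vec p}_{\vec\alpha}(T_B\times T_B)$ to $L^\infty(T_B\times T_B)$; (3) $a_1>0$, $a_2>0$, $p_1(b_1+1)>\alpha_1+1$, $b_2>-1$, $c_1=n+1+a_1+b_1-\frac{n+1+\alpha_1}{p_1}$, and $c_2=n+1+a_2+b_2$.
   Context: Let $n$ be a positive integer. For $z=(z_1,\dots,z_n)\in\mathbb{C}^n$ write $z=x+iy$ with $x,y\in\mathbb{R}^n$, $z'=(z_1,\dots,z_{n-1})$, $y'=(y_1,\dots,y_{n-1})$. Let $B=\{y\in\mathbb{R}^n: |y'|^2<y_n\}$ and $T_B=\{x+iy: x\in\mathbb{R}^n, y\in B\}$. For $z\in T_B$ put $\rho(z)=y_n-|y'|^2>0$, and for $z,u\in T_B$ put $\rho(z,u)=\frac14\big(\sum_{j=1}^{n-1}(z_j-\overline{u_j})^2-2i(z_n-\overline{u_n})\big)$; this has positive real part, and complex powers $\rho(z,u)^c$ are taken with the principal branch. $dV$ is Lebesgue measure on $\mathbb{C}^n$ and $dV_\alpha(z)=\rho(z)^\alpha dV(z)$. For $\vec p=(p_1,p_2)\in[1,\infty]^2$ and $\vec\alpha=(\alpha_1,\alpha_2)$,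 $L^{\vec p}_{\vec\alpha}(T_B\times T_B)$ is the space of measurable $f$ on $T_B\times T_B$ with finite mixed norm $\|f\|_{\vec p,\vec\alpha}=\big\{\int_{T_B}\big(\int_{T_B}|f(z,w)|^{p_1}dV_{\alpha_1}(z)\big)^{p_2/p_1}dV_{\alpha_2}(w)\big\}^{1/p_2}$, with the inner (resp. outer) integral replaced by an essential supremum in $z$ (resp. $w$) when $p_1=\infty$ (resp. $p_2=\infty$); when $\vec p=(\infty,\infty)$ this is $L^\infty(T_B\times T_B)$. For $\vec a=(a_1,a_2),\vec b=(b_1,b_2),\vec c=(c_1,c_2)\in\mathbb{R}^2$, $T_{\vec a,\vec b,\vec c}f(z,w)=\rho(z)^{a_1}\rho(w)^{a_2}\int_{T_B}\int_{T_B}\frac{\rho(u)^{b_1}\rho(\eta)^{b_2}}{\rho(z,u)^{c_1}\rho(w,\eta)^{c_2}}f(u,\eta)\,dV(u)\,dV(\eta)$ and $S_{\vec a,\vec b,\vec c}f(z,w)=\rho(z)^{a_1}\rho(w)^{a_2}\int_{T_B}\int_{T_B}\frac{\rho(u)^{b_1}\rho(\eta)^{b_2}}{|\rho(z,u)|^{c_1}|\rho(w,\eta)|^{c_2}}f(u,\eta)\,dV(u)\,dV(\eta)$. An operator is bounded from $X$ to $Y$ if for every $f\in X$ the defining integral converges for a.e. $(z,w)$ and $\|Tf\|_Y\le C\|f\|_X$ with $C$ independent of $f$. *)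

theory Defs
  imports "HOL-Analysis.Analysis" "HOL-Probability.Essential_Supremum"
begin

text \<open>Points of C^n are vectors z :: complex^'n, with n = CARD('n).
  The distinguished index k plays the role of the last coordinate z_n;
  the remaining indices form z'.\<close>

definition rho :: "'n::finite \<Rightarrow> complex^'n \<Rightarrow> real" where
  "rho k z = Im (z $ k) - (\<Sum>j\<in>UNIV - {k}. (Im (z $ j))\<^sup>2)"

definition TB :: "'n::finite \<Rightarrow> (complex^'n) set" where
  "TB k = {z. rho k z > 0}"

definition rho2 :: "'n::finite \<Rightarrow> complex^'n \<Rightarrow> complex^'n \<Rightarrow> complex" where
  "rho2 k z u = (1/4) * ((\<Sum>j\<in>UNIV - {k}. (z $ j - cnj (u $ j))\<^sup>2) - 2 * \<i> * (z $ k - cnj (u $ k)))"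

definition volTB :: "'n::finite \<Rightarrow> (complex^'n) measure" where
  "volTB k = restrict_space lborel (TB k)"

definition dVa :: "'n::finite \<Rightarrow> real \<Rightarrow> (complex^'n) measure" where
  "dVa k \<alpha> = density (volTB k) (\<lambda>z. ennreal (rho k z powr \<alpha>))"

definition enn_root :: "real \<Rightarrow> ennreal \<Rightarrow> ennreal" where
  "enn_root p x = (if x = \<infinity> then \<infinity> else ennreal (enn2real x powr (1/p)))"

definition mixnorm_inf :: "'n::finite \<Rightarrow> real \<Rightarrow> real \<Rightarrow> real \<Rightarrow>
    ((complex^'n) \<times> (complex^'n) \<Rightarrow> complex) \<Rightarrow> ennreal" where
  "mixnorm_inf k p1 \<alpha>1 \<alpha>2 f =
     esssup (dVa k \<alpha>2) (\<lambda>w. enn_root p1 (\<integral>\<^sup>+ z. ennreal (cmod (f (z, w)) powr p1) \<partial>dVa k \<alpha>1))"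

definition Lmix_inf :: "'n::finite \<Rightarrow> real \<Rightarrow> real \<Rightarrow> real \<Rightarrow>
    ((complex^'n) \<times> (complex^'n) \<Rightarrow> complex) set" where
  "Lmix_inf k p1 \<alpha>1 \<alpha>2 = {f. f \<in> borel_measurable (volTB k \<Otimes>\<^sub>M volTB k)
       \<and> mixnorm_inf k p1 \<alpha>1 \<alpha>2 f < \<infinity>}"

definition kerT :: "'n::finite \<Rightarrow> real \<times> real \<Rightarrow> real \<times> real \<Rightarrow> real \<times> real \<Rightarrow>
    (complex^'n) \<times> (complex^'n) \<Rightarrow> (complex^'n) \<times> (complex^'n) \<Rightarrow> complex" where
  "kerT k a b c zw ue =
     (case zw of (z, w) \<Rightarrow> case ue of (u, \<eta>) \<Rightarrow>
       complex_of_real (rho k z powr fst a * rho k w powr snd a * rho k u powr fst b * rho k \<eta> powr snd b)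
       / (rho2 k z u powr complex_of_real (fst c) * rho2 k w \<eta> powr complex_of_real (snd c)))"

definition kerS :: "'n::finite \<Rightarrow> real \<times> real \<Rightarrow> real \<times> real \<Rightarrow> real \<times> real \<Rightarrow>
    (complex^'n) \<times> (complex^'n) \<Rightarrow> (complex^'n) \<times> (complex^'n) \<Rightarrow> complex" where
  "kerS k a b c zw ue =
     (case zw of (z, w) \<Rightarrow> case ue of (u, \<eta>) \<Rightarrow>
       complex_of_real (rho k z powr fst a * rho k w powr snd a * rho k u powr fst b * rho k \<eta> powr snd b
       / (cmod (rho2 k z u) powr fst c * cmod (rho2 k w \<eta>) powr snd c)))"

definition intop :: "'n::finite \<Rightarrow> ((complex^'n) \<times> (complex^'n) \<Rightarrow> (complex^'n) \<times> (complex^'n) \<Rightarrow> complex) \<Rightarrow>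
    ((complex^'n) \<times> (complex^'n) \<Rightarrow> complex) \<Rightarrow> (complex^'n) \<times> (complex^'n) \<Rightarrow> complex" where
  "intop k K f zw = (\<integral> ue. K zw ue * f ue \<partial>(volTB k \<Otimes>\<^sub>M volTB k))"

definition bounded_to_Linf :: "'n::finite \<Rightarrow> real \<Rightarrow> real \<Rightarrow> real \<Rightarrow>
    ((complex^'n) \<times> (complex^'n) \<Rightarrow> (complex^'n) \<times> (complex^'n) \<Rightarrow> complex) \<Rightarrow> bool" where
  "bounded_to_Linf k p1 \<alpha>1 \<alpha>2 K \<longleftrightarrow>
     (\<exists>C::real. \<forall>f \<in> Lmix_inf k p1 \<alpha>1 \<alpha>2.
        (AE zw in volTB k \<Otimes>\<^sub>M volTB k. integrable (volTB k \<Otimes>\<^sub>M volTB k) (\<lambda>ue. K zw ue * f ue))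
      \<and> (AE zw in volTB k \<Otimes>\<^sub>M volTB k.
           ennreal (cmod (intop k K f zw)) \<le> ennreal C * mixnorm_inf k p1 \<alpha>1 \<alpha>2 f))"

end

theory Submission
  imports Defs
begin

text \<open>
  Both kernels have modulus \<open>\<rho>(z)^a1 \<rho>(u)^b1 |\<rho>(z,u)|^-c1\<close> times the analogous factor in \<open>(w, \<eta>)\<close>, so
  everything reduces to the integral of \<open>\<rho>(u)^B |\<rho>(z,u)|^-C\<close> over \<open>T_B\<close>. Because
  \<open>Re \<rho>(z,u) = (\<rho>(z) + \<rho>(u))/2 + |z' - u'|^2/4\<close> and \<open>Im \<rho>(z,u)\<close> is affine in \<open>Re u_n\<close>, integrating out one
  real coordinate at a time shows that it equals \<open>const * \<rho>(z)^(n+1+B-C)\<close>, with a constant in \<open>(0,\<infinity>]\<close> which is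
  finite iff \<open>B > -1\<close> and \<open>C > n+1+B\<close>. Sufficiency is then Hoelder's inequality in \<open>u\<close>, with exponent \<open>p1\<close>
  and dual exponent \<open>q\<close>. For necessity, test functions with compact support whose phase cancels that of the
  kernel at a given point \<open>(z,w)\<close>, and whose modulus is the extremal function of Hoelder's inequality, show that
  the \<open>L^q\<close> norm of the first kernel factor at \<open>z\<close> times the \<open>L^1\<close> norm of the second one at \<open>w\<close> is bounded;
  the almost everywhere bound holds at every point since the image of such a test function is continuous. Both
  norms are powers of \<open>\<rho>\<close> times constants, hence the constants are finite and the exponents vanish.
\<close>

section \<open>Integrals of powers on the line\<close>

text \<open>For D > 1/2 this is sqrt(pi) Gamma(D - 1/2) / Gamma(D). As an \<open>ennreal\<close> it
  is infinite for the other D, so that the integral formulas below hold for all exponents without a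
  convergence hypothesis.\<close>

definition kappa :: "real \<Rightarrow> ennreal" where
  "kappa D = (\<integral>\<^sup>+v. ennreal ((1 + v\<^sup>2) powr (- D)) \<partial>lborel)"

text \<open>The Beta function at (B + 1, E - B - 1), in the form of an integral over the half-line;
  again infinite when it diverges.\<close>

definition beta2 :: "real \<Rightarrow> real \<Rightarrow> ennreal" where
  "beta2 B E = (\<integral>\<^sup>+t. ennreal (t powr B * (1 + t) powr (- E)) * indicator {0<..} t \<partial>lborel)"

text \<open>Positivity of the constants is what the converse directions rest on: in
  \<open>ennreal\<close> zero times infinity is zero, so a finite product has finite factors only if
  none of them vanishes. Positivity on the half-line suffices since the unit interval has positive
  measure.\<close>

lemma nn_integral_pos_lborel:
  fixes f :: "real \<Rightarrow> ennreal"
  assumes [measurable]: "f \<in> borel_measurable borel" and pos: "\<And>x. 0 < x \<Longrightarrow> 0 < f x"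
  shows "0 < (\<integral>\<^sup>+x. f x \<partial>lborel)"
proof (rule ccontr)
  assume "\<not> ?thesis"
  then have "AE x in lborel. f x = 0"
    by (subst (asm) not_gr_zero) (simp add: nn_integral_0_iff_AE)
  then have "AE x in lborel. x \<notin> {0<..<1::real}"
    by (rule AE_mp) (use pos in \<open>force intro!: AE_I2\<close>)
  then have "{0<..<1::real} \<in> null_sets lborel"
    by (subst AE_iff_null_sets) auto
  then show False
    by (simp add: null_sets_def)
qed

lemma kappa_pos: "0 < kappa D"
  unfolding kappa_def
  by (rule nn_integral_pos_lborel) (auto simp: powr_def add_nonneg_eq_0_iff)

lemma beta2_pos: "0 < beta2 B E"
  unfolding beta2_def
  by (rule nn_integral_pos_lborel) (auto simp: powr_def)

text \<open>Substituting v = \<zeta> + sqrt M * v' takes the factor M^(-D) out of the integrand and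
  sqrt M out of the measure.\<close>

lemma nn_integral_powr_shift:
  fixes M \<zeta> D :: real
  assumes M: "0 < M"
  shows "(\<integral>\<^sup>+v. ennreal ((M + (v - \<zeta>)\<^sup>2) powr (- D)) \<partial>lborel) = ennreal (M powr (1/2 - D)) * kappa D"
proof -
  have "(\<integral>\<^sup>+v. ennreal ((M + (v - \<zeta>)\<^sup>2) powr (- D)) \<partial>lborel)
      = ennreal \<bar>sqrt M\<bar> * (\<integral>\<^sup>+v. ennreal ((M + (\<zeta> + sqrt M * v - \<zeta>)\<^sup>2) powr (- D)) \<partial>lborel)"
    using M by (intro nn_integral_real_affine) auto
  also have "(\<lambda>v. ennreal ((M + (\<zeta> + sqrt M * v - \<zeta>)\<^sup>2) powr (- D)))
      = (\<lambda>v. ennreal (M powr (- D)) * ennreal ((1 + v\<^sup>2) powr (- D)))"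
  proof
    fix v
    have "M + (\<zeta> + sqrt M * v - \<zeta>)\<^sup>2 = M * (1 + v\<^sup>2)"
      using M by (simp add: power_mult_distrib algebra_simps)
    then show "ennreal ((M + (\<zeta> + sqrt M * v - \<zeta>)\<^sup>2) powr (- D)) = ennreal (M powr (- D)) * ennreal ((1 + v\<^sup>2) powr (- D))"
      using M by (simp add: powr_mult ennreal_mult')
  qed
  also have "(\<integral>\<^sup>+v. ennreal (M powr (- D)) * ennreal ((1 + v\<^sup>2) powr (- D)) \<partial>lborel) = ennreal (M powr (- D)) * kappa D"
    unfolding kappa_def by (rule nn_integral_cmult) simp
  also have "ennreal \<bar>sqrt M\<bar> * (ennreal (M powr (- D)) * kappa D) = ennreal (M powr (1/2 - D)) * kappa D"
  proof -
    have "\<bar>sqrt M\<bar> * M powr (- D) = M powr (1/2 - D)"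
      using M by (simp add: powr_half_sqrt [symmetric] powr_add [symmetric])
    then show ?thesis
      by (metis ennreal_mult' abs_ge_zero mult.assoc)
  qed
  finally show ?thesis .
qed

text \<open>Substituting t = c + M * t' takes M^(B - E) out of the integrand and M out of the
  measure.\<close>

lemma nn_integral_powr_halfline:
  fixes M c B E :: real
  assumes M: "0 < M"
  shows "(\<integral>\<^sup>+t. ennreal ((t - c) powr B * (M + (t - c)) powr (- E)) * indicator {c<..} t \<partial>lborel)
       = ennreal (M powr (B + 1 - E)) * beta2 B E"
proof -
  have "(\<integral>\<^sup>+t. ennreal ((t - c) powr B * (M + (t - c)) powr (- E)) * indicator {c<..} t \<partial>lborel)
      = ennreal \<bar>M\<bar> * (\<integral>\<^sup>+t. ennreal ((c + M * t - c) powr B * (M + (c + M * t - c)) powr (- E)) * indicator {c<..} (c + M * t) \<partial>lborel)"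
    using M by (intro nn_integral_real_affine) auto
  also have "(\<lambda>t. ennreal ((c + M * t - c) powr B * (M + (c + M * t - c)) powr (- E)) * indicator {c<..} (c + M * t))
      = (\<lambda>t. ennreal (M powr (B - E)) * (ennreal (t powr B * (1 + t) powr (- E)) * indicator {0<..} t))"
  proof
    fix t
    have "(c + M * t - c) powr B * (M + (c + M * t - c)) powr (- E) = M powr (B - E) * (t powr B * (1 + t) powr (- E))"
      if "0 < t"
    proof -
      have "M + (c + M * t - c) = M * (1 + t)" by (simp add: algebra_simps)
      then show ?thesis using M that by (simp add: powr_mult powr_diff powr_minus divide_inverse)
    qed
    then have "0 < t \<Longrightarrow> ennreal ((c + M * t - c) powr B * (M + (c + M * t - c)) powr (- E))
        = ennreal (M powr (B - E)) * ennreal (t powr B * (1 + t) powr (- E))"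
      by (metis ennreal_mult' powr_ge_zero)
    then show "ennreal ((c + M * t - c) powr B * (M + (c + M * t - c)) powr (- E)) * indicator {c<..} (c + M * t)
      = ennreal (M powr (B - E)) * (ennreal (t powr B * (1 + t) powr (- E)) * indicator {0<..} t)"
      using M by (cases "0 < t") (simp_all add: indicator_def zero_less_mult_iff)
  qed
  also have "(\<integral>\<^sup>+t. ennreal (M powr (B - E)) * (ennreal (t powr B * (1 + t) powr (- E)) * indicator {0<..} t) \<partial>lborel)
      = ennreal (M powr (B - E)) * beta2 B E"
    unfolding beta2_def by (rule nn_integral_cmult) simp
  also have "ennreal \<bar>M\<bar> * (ennreal (M powr (B - E)) * beta2 B E) = ennreal (M powr (B + 1 - E)) * beta2 B E"
  proof -
    have "\<bar>M\<bar> * M powr (B - E) = M powr (B + 1 - E)"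
      using M by (simp add: powr_mult_base algebra_simps)
    then show ?thesis
      by (metis ennreal_mult' abs_ge_zero mult.assoc)
  qed
  finally show ?thesis .
qed

section \<open>Convergence and divergence of the one-dimensional integrals\<close>

lemma nn_integral_powr_from_0_finite:
  assumes "-1 < (e::real)"
  shows "(\<integral>\<^sup>+t. ennreal (t powr e) * indicator {0..1} t \<partial>lborel) < \<infinity>"
proof -
  have "(\<integral>\<^sup>+t. ennreal (indicator {0..1} t * t powr e) \<partial>lborel) = ennreal (1 powr (e+1) / (e+1))"
    using has_integral_powr_from_0[of e 1] assms by (intro nn_integral_has_integral_lebesgue) auto
  moreover have "(\<integral>\<^sup>+t. ennreal (indicator {0..1} t * t powr e) \<partial>lborel)
      = (\<integral>\<^sup>+t. ennreal (t powr e) * indicator {0..1} t \<partial>lborel)"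
    by (intro nn_integral_cong) (auto simp: indicator_def)
  ultimately show ?thesis
    by simp
qed

lemma nn_integral_powr_to_inf_finite:
  assumes "(e::real) < -1"
  shows "(\<integral>\<^sup>+t. ennreal (t powr e) * indicator {1..} t \<partial>lborel) < \<infinity>"
proof -
  have "(\<integral>\<^sup>+t. ennreal (indicator {1..} t * t powr e) \<partial>lborel) = ennreal (- (1 powr (e+1)) / (e+1))"
    using has_integral_powr_to_inf[of e 1] assms by (intro nn_integral_has_integral_lebesgue) auto
  moreover have "(\<integral>\<^sup>+t. ennreal (indicator {1..} t * t powr e) \<partial>lborel)
      = (\<integral>\<^sup>+t. ennreal (t powr e) * indicator {1..} t \<partial>lborel)"
    by (intro nn_integral_cong) (auto simp: indicator_def)
  ultimately show ?thesis
    by simp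
qed

lemma nn_integral_inverse_Icc:
  fixes r s :: real
  assumes "0 < r" "r \<le> s"
  shows "(\<integral>\<^sup>+t. ennreal (1 / t) * indicator {r..s} t \<partial>lborel) = ennreal (ln s - ln r)"
  using assms by (intro nn_integral_FTC_Icc) (auto intro!: derivative_eq_intros)

lemma ennreal_eq_infinity_if_unbounded:
  fixes X :: ennreal
  assumes "\<And>x. 0 \<le> x \<Longrightarrow> ennreal x \<le> X"
  shows "X = \<infinity>"
proof (cases X)
  case (real x)
  with assms[of "x + 1"] show ?thesis
    by (simp add: ennreal_le_iff)
qed simp

text \<open>The integral of c/t over [1, exp r] is c * r, and r is arbitrary. The next lemma is the
  counterpart at 0, with the interval [exp (- r), 1].\<close>

lemma nn_integral_ge_inverse_to_inf:
  fixes f :: "real \<Rightarrow> ennreal"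
  assumes c: "0 < c" and f: "\<And>t. 1 \<le> t \<Longrightarrow> ennreal (c / t) \<le> f t"
  shows "(\<integral>\<^sup>+t. f t \<partial>lborel) = \<infinity>"
proof -
  have "ennreal (c * r) \<le> (\<integral>\<^sup>+t. f t \<partial>lborel)" if "0 \<le> r" for r
  proof -
    have "ennreal (c * r) = ennreal c * (\<integral>\<^sup>+t. ennreal (1 / t) * indicator {1..exp r} t \<partial>lborel)"
      using that c by (subst nn_integral_inverse_Icc) (simp_all add: ennreal_mult)
    also have "\<dots> = (\<integral>\<^sup>+t. ennreal c * (ennreal (1 / t) * indicator {1..exp r} t) \<partial>lborel)"
      by (rule nn_integral_cmult [symmetric]) simp
    also have "\<dots> \<le> (\<integral>\<^sup>+t. f t \<partial>lborel)"
      using f c by (intro nn_integral_mono) (auto simp: indicator_def ennreal_mult' [symmetric])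
    finally show ?thesis .
  qed
  from this[of "x / c" for x] show ?thesis
    using c by (intro ennreal_eq_infinity_if_unbounded) auto
qed

lemma nn_integral_ge_inverse_from_0:
  fixes f :: "real \<Rightarrow> ennreal"
  assumes c: "0 < c" and f: "\<And>t. 0 < t \<Longrightarrow> t \<le> 1 \<Longrightarrow> ennreal (c / t) \<le> f t"
  shows "(\<integral>\<^sup>+t. f t \<partial>lborel) = \<infinity>"
proof -
  have "ennreal (c * r) \<le> (\<integral>\<^sup>+t. f t \<partial>lborel)" if "0 \<le> r" for r
  proof -
    have "ennreal (c * r) = ennreal c * (\<integral>\<^sup>+t. ennreal (1 / t) * indicator {exp (- r)..1} t \<partial>lborel)"
      using that c by (subst nn_integral_inverse_Icc) (simp_all add: ennreal_mult)
    also have "\<dots> = (\<integral>\<^sup>+t. ennreal c * (ennreal (1 / t) * indicator {exp (- r)..1} t) \<partial>lborel)"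
      by (rule nn_integral_cmult [symmetric]) simp
    also have "\<dots> \<le> (\<integral>\<^sup>+t. f t \<partial>lborel)"
    proof (intro nn_integral_mono)
      fix t :: real
      have "exp (- r) \<le> t \<Longrightarrow> 0 < t"
        by (meson exp_gt_zero less_le_trans)
      then show "ennreal c * (ennreal (1 / t) * indicator {exp (- r)..1} t) \<le> f t"
        using f[of t] c by (auto simp: indicator_def ennreal_mult' [symmetric])
    qed
    finally show ?thesis .
  qed
  from this[of "x / c" for x] show ?thesis
    using c by (intro ennreal_eq_infinity_if_unbounded) auto
qed

text \<open>The integrand is at most 1 on [-1, 1] and at most |v|^(-2D) on the two tails, where -2D
  < -1.\<close>

lemma kappa_finite:
  assumes "1/2 < D"
  shows "kappa D < \<infinity>"
proof -
  \<comment> \<open>Reflection at 0 identifies the left tail with the right one.\<close>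
  have refl: "(\<integral>\<^sup>+t. ennreal ((- t) powr (- 2 * D)) * indicator {1..} (- t) \<partial>lborel)
      = (\<integral>\<^sup>+t. ennreal (t powr (- 2 * D)) * indicator {1..} t \<partial>lborel)"
    by (subst nn_integral_real_affine[where c = "-1" and t = 0]) (auto simp: one_ennreal_def[symmetric])
  have tail: "(1 + v\<^sup>2) powr (- D) \<le> v powr (- 2 * D)" if "1 \<le> v" for v :: real
  proof -
    have "v powr (- 2 * D) = (v\<^sup>2) powr (- D)"
      using that by (simp add: powr_powr flip: powr_numeral)
    moreover have "(1 + v\<^sup>2) powr (- D) \<le> (v\<^sup>2) powr (- D)"
      using that assms by (intro powr_mono2') auto
    ultimately show ?thesis by simp
  qed
  have "kappa D \<le> (\<integral>\<^sup>+v. indicator {-1..1} v + (ennreal (v powr (- 2 * D)) * indicator {1..} v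
      + ennreal ((- v) powr (- 2 * D)) * indicator {1..} (- v)) \<partial>lborel)"
    unfolding kappa_def
  proof (rule nn_integral_mono)
    fix v :: real
    consider "\<bar>v\<bar> \<le> 1" | "1 < v" | "v < -1" by linarith
    then show "ennreal ((1 + v\<^sup>2) powr (- D)) \<le> indicator {-1..1} v + (ennreal (v powr (- 2 * D)) * indicator {1..} v
      + ennreal ((- v) powr (- 2 * D)) * indicator {1..} (- v))"
    proof cases
      case 1
      have "(1 + v\<^sup>2) powr (- D) \<le> 1 powr (- D)"
        using assms by (intro powr_mono2') auto
      then have "ennreal ((1 + v\<^sup>2) powr (- D)) \<le> 1"
        by (simp add: ennreal_le_1)
      then show ?thesis using 1
        by (simp add: indicator_def abs_le_iff add_increasing2)
    next
      case 2
      then show ?thesis using tail[of v] by (simp add: indicator_def)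
    next
      case 3
      then show ?thesis using tail[of "- v"] by (simp add: indicator_def)
    qed
  qed
  also have "\<dots> = 2 + ((\<integral>\<^sup>+v. ennreal (v powr (- 2 * D)) * indicator {1..} v \<partial>lborel)
      + (\<integral>\<^sup>+v. ennreal ((- v) powr (- 2 * D)) * indicator {1..} (- v) \<partial>lborel))"
    by (simp add: nn_integral_add)
  also have "\<dots> < \<infinity>"
    unfolding refl using nn_integral_powr_to_inf_finite[of "- 2 * D"] assms by (simp add: ennreal_add_less_top)
  finally show ?thesis .
qed

text \<open>For t >= 1 one has 1 + t^2 <= 2 t^2, so for D <= 1/2 the integrand dominates 1 / (sqrt 2
  * t), which is not integrable at infinity.\<close>

lemma kappa_finite_imp:
  assumes "kappa D < \<infinity>"
  shows "1/2 < D"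
proof (rule ccontr)
  assume D: "\<not> 1/2 < D"
  have "kappa D = \<infinity>"
    unfolding kappa_def
  proof (rule nn_integral_ge_inverse_to_inf[of "1 / sqrt 2"])
    fix t :: real assume t: "1 \<le> t"
    have "1 / sqrt 2 / t = (2 * t\<^sup>2) powr (- (1/2))"
      using t by (simp add: powr_minus powr_half_sqrt real_sqrt_mult field_simps)
    also have "\<dots> \<le> (1 + t\<^sup>2) powr (- (1/2))"
      using t by (intro powr_mono2') (auto simp: add_pos_nonneg)
    also have "\<dots> \<le> (1 + t\<^sup>2) powr (- D)"
      using D by (intro powr_mono) auto
    finally show "ennreal (1 / sqrt 2 / t) \<le> ennreal ((1 + t\<^sup>2) powr (- D))"
      by (rule ennreal_leI)
  qed simp
  then show False using assms by simp
qed

text \<open>The integrand is dominated by t^B on (0, 1] and by t^(B - E) beyond 1; the two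
  hypotheses make these integrable at 0 and at infinity respectively.\<close>

lemma beta2_finite:
  assumes "-1 < B" "B + 1 < E"
  shows "beta2 B E < \<infinity>"
proof -
  have "beta2 B E \<le> (\<integral>\<^sup>+t. ennreal (t powr B) * indicator {0..1} t + ennreal (t powr (B - E)) * indicator {1..} t \<partial>lborel)"
    unfolding beta2_def
  proof (rule nn_integral_mono)
    fix t :: real
    consider "t \<le> 0" | "0 < t" "t \<le> 1" | "1 < t" by linarith
    then show "ennreal (t powr B * (1 + t) powr (- E)) * indicator {0<..} t
       \<le> ennreal (t powr B) * indicator {0..1} t + ennreal (t powr (B - E)) * indicator {1..} t"
    proof cases
      case 1 then show ?thesis by simp
    next
      case 2
      have "(1 + t) powr (- E) \<le> 1 powr (- E)"
        using assms 2 by (intro powr_mono2') auto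
      then have "t powr B * (1 + t) powr (- E) \<le> t powr B"
        by (simp add: mult_left_le)
      then have "ennreal (t powr B * (1 + t) powr (- E)) \<le> ennreal (t powr B)"
        by (rule ennreal_leI)
      then show ?thesis using 2
        by (simp add: indicator_def add_increasing2)
    next
      case 3
      have "(1 + t) powr (- E) \<le> t powr (- E)"
        using assms 3 by (intro powr_mono2') auto
      then have "t powr B * (1 + t) powr (- E) \<le> t powr B * t powr (- E)"
        by (intro mult_left_mono) auto
      also have "\<dots> = t powr (B - E)"
        by (simp add: powr_add [symmetric])
      finally have "ennreal (t powr B * (1 + t) powr (- E)) \<le> ennreal (t powr (B - E))"
        by (rule ennreal_leI)
      then show ?thesis using 3
        by (simp add: indicator_def add_increasing2)
    qed
  qed
  also have "\<dots> = (\<integral>\<^sup>+t. ennreal (t powr B) * indicator {0..1} t \<partial>lborel)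
      + (\<integral>\<^sup>+t. ennreal (t powr (B - E)) * indicator {1..} t \<partial>lborel)"
    by (intro nn_integral_add) simp_all
  also have "\<dots> < \<infinity>"
    using nn_integral_powr_from_0_finite[of B] nn_integral_powr_to_inf_finite[of "B - E"] assms
    by (simp add: ennreal_add_less_top)
  finally show ?thesis .
qed

lemma beta2_finite_imp:
  assumes "beta2 B E < \<infinity>"
  shows "-1 < B" "B + 1 < E"
proof -
  \<comment> \<open>\<open>c\<close> bounds s^(-E) from below on [1, 2] for either sign of E. It is
    used with s = 1 + t near 0 and with s = (1 + t) / t near infinity, which compares the integrand
    with c / t at both ends.\<close>
  define c where "c = min 1 (2 powr (- E))"
  have c: "0 < c" by (simp add: c_def)
  have cE: "c \<le> s powr (- E)" if "1 \<le> s" "s \<le> 2" for s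
  proof (cases "0 \<le> E")
    case True
    then have "2 powr (- E) \<le> s powr (- E)" using that by (intro powr_mono2') auto
    then show ?thesis by (simp add: c_def)
  next
    case False
    then have "1 \<le> s powr (- E)" using that by (intro ge_one_powr_ge_zero) auto
    then show ?thesis by (simp add: c_def)
  qed
  show "-1 < B"
  proof (rule ccontr)
    assume B: "\<not> -1 < B"
    have "beta2 B E = \<infinity>"
      unfolding beta2_def
    proof (rule nn_integral_ge_inverse_from_0[OF c])
      fix t :: real assume t: "0 < t" "t \<le> 1"
      have "c / t = t powr (-1) * c"
        using t by (simp add: powr_minus divide_inverse)
      also have "\<dots> \<le> t powr B * (1 + t) powr (- E)"
        using B t c cE[of "1 + t"] by (intro mult_mono powr_mono') auto
      finally show "ennreal (c / t) \<le> ennreal (t powr B * (1 + t) powr (- E)) * indicator {0<..} t"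
        using t by (simp add: ennreal_leI)
    qed
    then show False using assms by simp
  qed
  show "B + 1 < E"
  proof (rule ccontr)
    assume B: "\<not> B + 1 < E"
    have "beta2 B E = \<infinity>"
      unfolding beta2_def
    proof (rule nn_integral_ge_inverse_to_inf[OF c])
      fix t :: real assume t: "1 \<le> t"
      have "c / t = t powr (-1) * c"
        using t by (simp add: powr_minus divide_inverse)
      \<comment> \<open>Writing the integrand as t^(B - E) * ((1 + t) / t)^(-E) isolates a factor
        whose base lies in [1, 2].\<close>
      also have "\<dots> \<le> t powr (B - E) * ((1 + t) / t) powr (- E)"
        using B t c cE[of "(1 + t) / t"] by (intro mult_mono powr_mono) (auto simp: field_simps)
      also have "\<dots> = t powr B * (1 + t) powr (- E)"
        using t by (simp add: powr_divide powr_diff powr_minus field_simps)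
      finally show "ennreal (c / t) \<le> ennreal (t powr B * (1 + t) powr (- E)) * indicator {0<..} t"
        using t by (simp add: ennreal_leI)
    qed
    then show False using assms by simp
  qed
qed

section \<open>The Forelli--Rudin integral on the tube domain\<close>

text \<open>Induction on the number of coordinates: when one of them is integrated out, the sum over
  the others joins M, the exponent D drops by 1/2 and a factor \<open>kappa D\<close>
  appears.\<close>

lemma nn_integral_PiM_powr_shift:
  fixes I :: "'i set" and \<zeta> :: "'i \<Rightarrow> real"
  assumes "finite I" "0 < M"
  shows "(\<integral>\<^sup>+x. ennreal ((M + (\<Sum>i\<in>I. (x i - \<zeta> i)\<^sup>2)) powr (- D)) \<partial>(\<Pi>\<^sub>M i\<in>I. lborel))
       = ennreal (M powr (real (card I) / 2 - D)) * (\<Prod>j<card I. kappa (D - real j / 2))"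
  using assms
proof (induction I arbitrary: D rule: finite_induct)
  case empty
  then show ?case by (simp add: PiM_empty)
next
  case (insert i I)
  interpret product_sigma_finite "\<lambda>_::'i. lborel :: real measure" ..
  have pos: "0 < M + (\<Sum>j\<in>I. (x j - \<zeta> j)\<^sup>2)" for x
    using insert.prems by (simp add: add_pos_nonneg sum_nonneg)
  have "(\<integral>\<^sup>+x. ennreal ((M + (\<Sum>j\<in>insert i I. (x j - \<zeta> j)\<^sup>2)) powr (- D)) \<partial>(\<Pi>\<^sub>M j\<in>insert i I. lborel))
      = (\<integral>\<^sup>+x. \<integral>\<^sup>+y. ennreal ((M + (\<Sum>j\<in>insert i I. ((x(i := y)) j - \<zeta> j)\<^sup>2)) powr (- D)) \<partial>lborel \<partial>(\<Pi>\<^sub>M j\<in>I. lborel))"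
    using insert.hyps by (intro product_nn_integral_insert) measurable
  also have "\<dots> = (\<integral>\<^sup>+x. kappa D * ennreal ((M + (\<Sum>j\<in>I. (x j - \<zeta> j)\<^sup>2)) powr (- (D - 1/2))) \<partial>(\<Pi>\<^sub>M j\<in>I. lborel))"
  proof (intro nn_integral_cong)
    fix x :: "'i \<Rightarrow> real"
    have eq: "M + (\<Sum>j\<in>insert i I. ((x(i := y)) j - \<zeta> j)\<^sup>2) = (M + (\<Sum>j\<in>I. (x j - \<zeta> j)\<^sup>2)) + (y - \<zeta> i)\<^sup>2" for y
    proof -
      have "(\<Sum>j\<in>I. ((x(i := y)) j - \<zeta> j)\<^sup>2) = (\<Sum>j\<in>I. (x j - \<zeta> j)\<^sup>2)"
        using insert.hyps by (intro sum.cong) auto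
      then show ?thesis using insert.hyps by simp
    qed
    show "(\<integral>\<^sup>+y. ennreal ((M + (\<Sum>j\<in>insert i I. ((x(i := y)) j - \<zeta> j)\<^sup>2)) powr (- D)) \<partial>lborel)
        = kappa D * ennreal ((M + (\<Sum>j\<in>I. (x j - \<zeta> j)\<^sup>2)) powr (- (D - 1/2)))"
      unfolding eq using nn_integral_powr_shift[OF pos] by (simp add: mult.commute)
  qed
  also have "\<dots> = kappa D * (ennreal (M powr (real (card I) / 2 - (D - 1/2))) * (\<Prod>j<card I. kappa (D - 1/2 - real j / 2)))"
    by (subst nn_integral_cmult) (simp_all only: insert.IH[OF insert.prems], measurable)
  also have "\<dots> = ennreal (M powr (real (card (insert i I)) / 2 - D)) * (\<Prod>j<card (insert i I). kappa (D - real j / 2))"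
  proof -
    \<comment> \<open>The factor j of the induction hypothesis is the factor j + 1 here; the new
      \<open>kappa D\<close> has index 0.\<close>
    have "D - 1/2 - real j / 2 = D - real (Suc j) / 2" for j
      by (simp add: field_simps)
    moreover have "real (card I) / 2 - (D - 1/2) = real (card (insert i I)) / 2 - D"
      using insert.hyps by (simp add: field_simps)
    ultimately show ?thesis
      unfolding card_insert_disjoint[OF insert.hyps] prod.lessThan_Suc_shift
      by (simp only: mult_ac o_def of_nat_0 div_0 diff_zero)
  qed
  finally show ?case .
qed

text \<open>In each summand (Re z - Re u)^2 - (Im z + Im u)^2 = |z - u|^2 - 2 (Im z)^2 - 2 (Im u)^2,
  and the two last terms complete Im z_k and Im u_k to \<open>rho k z\<close> and
  \<open>rho k u\<close>.\<close>

lemma Re_rho2: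
  "Re (rho2 k z u) = (rho k z + rho k u) / 2 + (\<Sum>j\<in>UNIV - {k}. (cmod (z $ j - u $ j))\<^sup>2) / 4"
proof -
  have "Re (rho2 k z u) = ((\<Sum>j\<in>UNIV - {k}. (Re (z $ j) - Re (u $ j))\<^sup>2 - (Im (z $ j) + Im (u $ j))\<^sup>2)
      + 2 * (Im (z $ k) + Im (u $ k))) / 4"
    by (simp add: rho2_def power2_eq_square)
  also have "(\<Sum>j\<in>UNIV - {k}. (Re (z $ j) - Re (u $ j))\<^sup>2 - (Im (z $ j) + Im (u $ j))\<^sup>2)
      = (\<Sum>j\<in>UNIV - {k}. (cmod (z $ j - u $ j))\<^sup>2 - 2 * (Im (z $ j))\<^sup>2 - 2 * (Im (u $ j))\<^sup>2)"
    by (intro sum.cong) (simp_all add: cmod_power2, simp add: power2_eq_square algebra_simps)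
  also have "\<dots> = (\<Sum>j\<in>UNIV - {k}. (cmod (z $ j - u $ j))\<^sup>2)
      - 2 * (\<Sum>j\<in>UNIV - {k}. (Im (z $ j))\<^sup>2) - 2 * (\<Sum>j\<in>UNIV - {k}. (Im (u $ j))\<^sup>2)"
    by (simp add: sum_subtractf sum_distrib_left)
  finally show ?thesis
    by (simp add: rho_def field_simps)
qed

text \<open>Written so as to exhibit the dependence on Re u_k: affine of slope 1/2, with a zero that
  depends only on z and on the remaining coordinates u'.\<close>

lemma Im_rho2:
  "Im (rho2 k z u) = (Re (u $ k) - (Re (z $ k) - (\<Sum>j\<in>UNIV - {k}. (Re (z $ j) - Re (u $ j)) * (Im (z $ j) + Im (u $ j))))) / 2"
proof -
  have "Im (rho2 k z u) = ((\<Sum>j\<in>UNIV - {k}. 2 * ((Re (z $ j) - Re (u $ j)) * (Im (z $ j) + Im (u $ j))))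
      - 2 * (Re (z $ k) - Re (u $ k))) / 4"
    by (simp add: rho2_def power2_eq_square algebra_simps)
  then show ?thesis
    unfolding sum_distrib_left [symmetric] by argo
qed

lemma Re_rho2_pos:
  assumes "z \<in> TB k" "u \<in> TB k"
  shows "0 < Re (rho2 k z u)"
  using assms unfolding Re_rho2 TB_def by (simp add: add_pos_nonneg sum_nonneg)

lemma continuous_on_rho [continuous_intros]:
  "continuous_on S f \<Longrightarrow> continuous_on S (\<lambda>x. rho k (f x))"
  unfolding rho_def by (intro continuous_intros)

lemma continuous_on_rho2 [continuous_intros]:
  "continuous_on S f \<Longrightarrow> continuous_on S g \<Longrightarrow> continuous_on S (\<lambda>x. rho2 k (f x) (g x))"
  unfolding rho2_def by (intro continuous_intros)

lemma open_TB: "open (TB k)"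
  unfolding TB_def by (intro open_Collect_less continuous_intros)

lemma rho_measurable [measurable]: "rho k \<in> borel_measurable borel"
  by (intro borel_measurable_continuous_onI continuous_intros)

lemma rho2_measurable [measurable]: "rho2 k z \<in> borel_measurable borel"
  by (intro borel_measurable_continuous_onI continuous_intros)

lemma TB_measurable [measurable]: "TB k \<in> sets borel"
  by (intro borel_open open_TB)

section \<open>Lebesgue measure on C^n in real coordinates\<close>

definition of_coords :: "(complex^'n \<Rightarrow> real) \<Rightarrow> complex^'n::finite" where
  "of_coords x = (\<Sum>b\<in>Basis. x b *\<^sub>R b)"

lemma Re_of_coords: "Re (of_coords x $ j) = x (axis j 1)"
proof -
  have "Re (of_coords x $ j) = of_coords x \<bullet> axis j 1"
    by (simp add: inner_axis inner_complex_def)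
  also have "\<dots> = x (axis j 1)"
    unfolding of_coords_def by (rule inner_sum_left_Basis) (auto simp: Basis_vec_def Basis_complex_def)
  finally show ?thesis .
qed

lemma Im_of_coords: "Im (of_coords x $ j) = x (axis j \<i>)"
proof -
  have "Im (of_coords x $ j) = of_coords x \<bullet> axis j \<i>"
    by (simp add: inner_axis inner_complex_def)
  also have "\<dots> = x (axis j \<i>)"
    unfolding of_coords_def by (rule inner_sum_left_Basis) (auto simp: Basis_vec_def Basis_complex_def)
  finally show ?thesis .
qed

text \<open>The basis vectors that carry the 2(n - 1) real coordinates of u'; the coordinates Re u_k
  and Im u_k are set apart.\<close>

definition other_axes :: "'n::finite \<Rightarrow> (complex^'n) set" where
  "other_axes k = (\<lambda>j. axis j 1) ` (UNIV - {k}) \<union> (\<lambda>j. axis j \<i>) ` (UNIV - {k})"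

lemma Basis_other_axes: "(Basis :: (complex^'n::finite) set) = insert (axis k 1) (insert (axis k \<i>) (other_axes k))"
  unfolding other_axes_def Basis_vec_def Basis_complex_def by auto

lemma axis_notin_other_axes:
  "axis k 1 \<notin> insert (axis k \<i>) (other_axes k)" "axis k \<i> \<notin> other_axes k"
  by (auto simp: other_axes_def axis_eq_axis complex_eq_iff)

lemma finite_other_axes: "finite (other_axes k)"
  by (simp add: other_axes_def)

lemma sum_other_axes: "(\<Sum>b\<in>other_axes k. f b) = (\<Sum>j\<in>UNIV - {k}. f (axis j 1) + f (axis j \<i>))"
proof -
  have "(\<Sum>b\<in>other_axes k. f b) = (\<Sum>b\<in>(\<lambda>j. axis j 1) ` (UNIV - {k}). f b) + (\<Sum>b\<in>(\<lambda>j. axis j \<i>) ` (UNIV - {k}). f b)"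
    unfolding other_axes_def
    by (intro sum.union_disjoint) (auto simp: axis_eq_axis complex_eq_iff)
  also have "\<dots> = (\<Sum>j\<in>UNIV - {k}. f (axis j 1)) + (\<Sum>j\<in>UNIV - {k}. f (axis j \<i>))"
    by (simp add: sum.reindex inj_on_def axis_eq_axis)
  finally show ?thesis by (simp add: sum.distrib)
qed

lemma card_other_axes: "card (other_axes (k::'n::finite)) = 2 * (CARD('n) - 1)"
proof -
  have "card (other_axes k) = (\<Sum>j\<in>UNIV - {k}. 2)"
    using sum_other_axes[where f = "\<lambda>_. 1::nat" and k = k] by simp
  then show ?thesis by (simp add: card_Diff_singleton)
qed

text \<open>The order of integration suits the kernel: Re u_k, which enters only through the
  imaginary part of \<open>rho2\<close>, is innermost; Im u_k, which for fixed u' amounts to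
  \<open>rho k u\<close>, comes next; u' comes last.\<close>

lemma nn_integral_lborel_coords:
  fixes F :: "complex^'n::finite \<Rightarrow> ennreal"
  assumes [measurable]: "F \<in> borel_measurable borel"
  shows "(\<integral>\<^sup>+u. F u \<partial>lborel) = (\<integral>\<^sup>+x. \<integral>\<^sup>+t. \<integral>\<^sup>+s.
    F (of_coords (x(axis k \<i> := t, axis k 1 := s))) \<partial>lborel \<partial>lborel \<partial>(\<Pi>\<^sub>M b\<in>other_axes k. lborel))"
proof -
  interpret product_sigma_finite "\<lambda>_::complex^'n. lborel :: real measure" ..
  have m: "of_coords \<in> (\<Pi>\<^sub>M b\<in>Basis. lborel) \<rightarrow>\<^sub>M (borel :: (complex^'n) measure)"
    unfolding of_coords_def by measurable
  have "(\<integral>\<^sup>+u. F u \<partial>lborel) = (\<integral>\<^sup>+x. F (of_coords x) \<partial>(\<Pi>\<^sub>M b\<in>Basis. lborel))"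
    by (subst lborel_eq) (simp add: nn_integral_distr of_coords_def)
  also have "\<dots> = (\<integral>\<^sup>+x. \<integral>\<^sup>+s. F (of_coords (x(axis k 1 := s))) \<partial>lborel
      \<partial>(\<Pi>\<^sub>M b\<in>insert (axis k \<i>) (other_axes k). lborel))"
    using m unfolding Basis_other_axes[of k]
    by (intro product_nn_integral_insert axis_notin_other_axes measurable_compose[OF _ assms]) (simp_all add: finite_other_axes)
  also have "\<dots> = (\<integral>\<^sup>+x. \<integral>\<^sup>+t. \<integral>\<^sup>+s.
    F (of_coords (x(axis k \<i> := t, axis k 1 := s))) \<partial>lborel \<partial>lborel \<partial>(\<Pi>\<^sub>M b\<in>other_axes k. lborel))"
  proof (rule product_nn_integral_insert)
    have [measurable]: "(\<lambda>p. (fst p)(axis k 1 := snd p)) \<in> (\<Pi>\<^sub>M b\<in>insert (axis k \<i>) (other_axes k). lborel) \<Otimes>\<^sub>M lborel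
        \<rightarrow>\<^sub>M (\<Pi>\<^sub>M b\<in>Basis :: (complex^'n) set. lborel :: real measure)"
      unfolding Basis_other_axes[of k] by measurable
    show "(\<lambda>x. \<integral>\<^sup>+s. F (of_coords (x(axis k 1 := s))) \<partial>lborel)
        \<in> borel_measurable (\<Pi>\<^sub>M b\<in>insert (axis k \<i>) (other_axes k). lborel)"
      by (intro sigma_finite_measure.borel_measurable_nn_integral lborel.sigma_finite_measure_axioms)
        (auto simp: case_prod_beta' intro!: measurable_compose[OF _ assms] measurable_compose[OF _ m])
  qed (simp_all add: axis_notin_other_axes finite_other_axes)
  finally show ?thesis .
qed

text \<open>The constant in the Forelli--Rudin formula below: \<open>kappa\<close> arises from integrating out one real
  coordinate of \<open>u'\<close> or \<open>Re (u $ k)\<close>, \<open>beta2\<close> from integrating out \<open>rho k u\<close>.\<close>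

definition FR :: "nat \<Rightarrow> real \<Rightarrow> real \<Rightarrow> ennreal" where
  "FR n B C = ennreal (2 powr (C + real (n - 1))) * (kappa (C / 2) * beta2 B (C - 1)
     * (\<Prod>j<2 * (n - 1). kappa (C - B - 2 - real j / 2)))"

lemma prod_kappa_pos: "0 < (\<Prod>j<(m::nat). kappa (g j))"
  by (induction m) (simp_all add: ennreal_zero_less_mult_iff kappa_pos)

lemma FR_pos: "0 < FR n B C"
  unfolding FR_def by (simp add: ennreal_zero_less_mult_iff kappa_pos beta2_pos prod_kappa_pos)

lemma ennreal_prod_lt_top: "(\<And>i. i \<in> A \<Longrightarrow> f i < top) \<Longrightarrow> (\<Prod>i\<in>A. f i) < (top::ennreal)"
  by (induction A rule: infinite_finite_induct) (auto simp: ennreal_mult_less_top)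

text \<open>The product of \<open>kappa\<close> factors is governed by its last index j = 2n - 3,
  whose condition reads exactly C > n + 1 + B. The factor \<open>beta2\<close> gives B > -1 and C >
  B + 2, and the condition C > 1 of \<open>kappa (C / 2)\<close> follows from the others.\<close>

lemma FR_finite_iff:
  assumes "0 < n"
  shows "FR n B C < \<infinity> \<longleftrightarrow> -1 < B \<and> real n + 1 + B < C"
proof
  assume "-1 < B \<and> real n + 1 + B < C"
  then have B: "-1 < B" and C: "real n + 1 + B < C" by auto
  have "kappa (C - B - 2 - real j / 2) < \<infinity>" if "j < 2 * (n - 1)" for j
  proof (rule kappa_finite)
    have "j + 3 \<le> 2 * n" using that assms by linarith
    then have "real j + 3 \<le> 2 * real n" by linarith
    then show "1/2 < C - B - 2 - real j / 2" using C by linarith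
  qed
  moreover have "kappa (C / 2) < \<infinity>"
    using B C assms by (intro kappa_finite) linarith
  moreover have "beta2 B (C - 1) < \<infinity>"
    using B C assms by (intro beta2_finite) linarith+
  ultimately show "FR n B C < \<infinity>"
    unfolding FR_def
    using ennreal_prod_lt_top[of "{..<2 * (n - 1)}" "\<lambda>j. kappa (C - B - 2 - real j / 2)"]
    by (simp add: ennreal_mult_less_top)
next
  assume fin: "FR n B C < \<infinity>"
  note pos = prod_kappa_pos
  have "kappa (C / 2) * beta2 B (C - 1) * (\<Prod>j<2 * (n - 1). kappa (C - B - 2 - real j / 2)) < \<infinity>"
    using fin unfolding FR_def by (auto simp: ennreal_mult_less_top)
  moreover have "kappa (C / 2) * beta2 B (C - 1) \<noteq> 0"
    using kappa_pos beta2_pos by (simp add: less_imp_neq[symmetric])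
  ultimately have b: "beta2 B (C - 1) < \<infinity>" and pr: "(\<Prod>j<2 * (n - 1). kappa (C - B - 2 - real j / 2)) < \<infinity>"
    using kappa_pos[of "C / 2"] pos[of "\<lambda>j. C - B - 2 - real j / 2" "2 * (n - 1)"]
    by (auto simp: ennreal_mult_less_top less_imp_neq[OF kappa_pos, symmetric])
  note B = beta2_finite_imp[OF b]
  show "-1 < B \<and> real n + 1 + B < C"
  \<comment> \<open>For n = 1 the product is empty, and the condition of \<open>beta2\<close> is
    already C > n + 1 + B.\<close>
  proof (cases "n = 1")
    case True
    then show ?thesis using B by simp
  next
    case False
    \<comment> \<open>The index 2n - 3 of the last factor, the most restrictive one.\<close>
    define m where "m = 2 * (n - 1) - 1"
    have m: "2 * (n - 1) = Suc m"
      using False assms by (simp add: m_def)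
    have "kappa (C - B - 2 - real m / 2) < \<infinity>"
      using pr pos[of "\<lambda>j. C - B - 2 - real j / 2" m]
      unfolding m by (auto simp: ennreal_mult_less_top less_imp_neq[OF kappa_pos, symmetric])
    then have "1/2 < C - B - 2 - real m / 2"
      by (rule kappa_finite_imp)
    moreover have "real m = 2 * (real n - 1) - 1"
      using False assms by (simp add: m_def of_nat_diff)
    ultimately have "real n + 1 + B < C" by argo
    then show ?thesis using B by simp
  qed
qed

text \<open>The three stages of integration produce powers of base M + rho(u), M and rho(z) with
  exponents 1 - C, B + 2 - C and n + 1 + B - C; all remaining factors are free of z. Both sides may
  be infinite.\<close>

theorem nn_integral_rho_powr:
  fixes k :: "'n::finite" and B C :: real
  assumes z: "z \<in> TB k"
  shows "(\<integral>\<^sup>+u. ennreal (rho k u powr B * cmod (rho2 k z u) powr (- C)) \<partial>volTB k)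
    = ennreal (rho k z powr (real CARD('n) + 1 + B - C)) * FR CARD('n) B C"
proof -
  define m where "m = 2 * (CARD('n) - 1)"
  \<comment> \<open>For fixed u', given by x: \<open>c x\<close> is |Im u'|^2, so rho(u) = t - c x;
    \<open>M x\<close> collects what Re \<open>rho2\<close> contains besides rho(u); and
    \<open>\<theta> x\<close> is the value of Re u_k at which Im \<open>rho2\<close>
    vanishes.\<close>
  define c where "c x = (\<Sum>j\<in>UNIV - {k}. (x (axis j \<i>))\<^sup>2)" for x :: "complex^'n \<Rightarrow> real"
  define M where "M x = rho k z + (\<Sum>b\<in>other_axes k. (x b - z \<bullet> b)\<^sup>2) / 2" for x :: "complex^'n \<Rightarrow> real"
  define \<theta> where "\<theta> x = Re (z $ k) - (\<Sum>j\<in>UNIV - {k}. (Re (z $ j) - x (axis j 1)) * (Im (z $ j) + x (axis j \<i>)))"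
    for x :: "complex^'n \<Rightarrow> real"
  define u where "u x t s = of_coords (x(axis k \<i> := t, axis k 1 := s))" for x :: "complex^'n \<Rightarrow> real" and t s
  have rz: "0 < rho k z" using z by (simp add: TB_def)
  have Mpos: "0 < M x" for x
    unfolding M_def using rz by (simp add: add_pos_nonneg sum_nonneg)
  have neq: "axis j a \<noteq> axis k b" if "j \<noteq> k" "a \<noteq> 0" for j a and b :: complex
    using that by (simp add: axis_eq_axis)
  have neq': "axis k \<i> \<noteq> axis k (1::complex)"
    by (simp add: axis_eq_axis complex_eq_iff)
  have coord: "Re (u x t s $ k) = s" "Im (u x t s $ k) = t"
      "j \<noteq> k \<Longrightarrow> Re (u x t s $ j) = x (axis j 1)" "j \<noteq> k \<Longrightarrow> Im (u x t s $ j) = x (axis j \<i>)" for x t s j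
    by (auto simp: u_def Re_of_coords Im_of_coords neq neq')
  have rho_u: "rho k (u x t s) = t - c x" for x t s
    by (simp add: rho_def coord c_def)
  have dist_u: "(\<Sum>j\<in>UNIV - {k}. (cmod (z $ j - u x t s $ j))\<^sup>2) = (\<Sum>b\<in>other_axes k. (x b - z \<bullet> b)\<^sup>2)" for x t s
    unfolding sum_other_axes
    by (intro sum.cong) (simp_all add: cmod_power2 coord inner_axis inner_complex_def power2_commute)
  have Re_u: "Re (rho2 k z (u x t s)) = (M x + (t - c x)) / 2" for x t s
    unfolding Re_rho2 dist_u rho_u M_def by (simp add: field_simps)
  have Im_u: "Im (rho2 k z (u x t s)) = (s - \<theta> x) / 2" for x t s
    unfolding Im_rho2 \<theta>_def by (simp add: coord)
  have abs_u: "cmod (rho2 k z (u x t s)) powr (- C)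
      = 2 powr C * ((M x + (t - c x))\<^sup>2 + (s - \<theta> x)\<^sup>2) powr (- (C / 2))" for x t s
  proof -
    have "cmod (rho2 k z (u x t s)) = sqrt ((M x + (t - c x))\<^sup>2 + (s - \<theta> x)\<^sup>2) / 2"
      unfolding cmod_def Re_u Im_u
      by (simp add: power_divide add_divide_distrib [symmetric] real_sqrt_divide)
    also have "\<dots> = ((M x + (t - c x))\<^sup>2 + (s - \<theta> x)\<^sup>2) powr (1/2) / 2"
      by (subst powr_half_sqrt) auto
    finally show ?thesis
      by (simp only: powr_divide powr_powr powr_minus) (simp add: field_simps)
  qed
  \<comment> \<open>The integral over Re u_k is of the form in
    \<open>nn_integral_powr_shift\<close>, with (M x + rho(u))^2 as its M and C/2 as its D.\<close>
  have inner: "(\<integral>\<^sup>+s. ennreal (rho k (u x t s) powr B * cmod (rho2 k z (u x t s)) powr (- C)) * indicator (TB k) (u x t s) \<partial>lborel)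
      = ennreal (2 powr C) * kappa (C / 2)
        * (ennreal ((t - c x) powr B * (M x + (t - c x)) powr (- (C - 1))) * indicator {c x<..} t)" for x t
  proof (cases "c x < t")
    case False
    then show ?thesis by (simp add: TB_def rho_u)
  next
    case True
    have p: "0 < M x + (t - c x)" using True Mpos[of x] by simp
    have "(\<integral>\<^sup>+s. ennreal (rho k (u x t s) powr B * cmod (rho2 k z (u x t s)) powr (- C)) * indicator (TB k) (u x t s) \<partial>lborel)
       = (\<integral>\<^sup>+s. ennreal ((t - c x) powr B * 2 powr C) * ennreal (((M x + (t - c x))\<^sup>2 + (s - \<theta> x)\<^sup>2) powr (- (C / 2))) \<partial>lborel)"
      using True by (intro nn_integral_cong) (simp add: TB_def rho_u abs_u ennreal_mult' mult.assoc)
    also have "\<dots> = ennreal ((t - c x) powr B * 2 powr C) * (ennreal (((M x + (t - c x))\<^sup>2) powr (1/2 - C/2)) * kappa (C / 2))"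
      using p by (subst nn_integral_cmult) (simp_all add: nn_integral_powr_shift)
    also have "((M x + (t - c x))\<^sup>2) powr (1/2 - C/2) = (M x + (t - c x)) powr (- (C - 1))"
      using p by (simp add: powr_powr flip: powr_numeral)
    finally show ?thesis using True
      by (simp add: ennreal_mult' mult_ac)
  qed
  have middle: "(\<integral>\<^sup>+t. \<integral>\<^sup>+s. ennreal (rho k (u x t s) powr B * cmod (rho2 k z (u x t s)) powr (- C)) * indicator (TB k) (u x t s) \<partial>lborel \<partial>lborel)
      = ennreal (2 powr C) * kappa (C / 2) * beta2 B (C - 1) * ennreal (M x powr (B + 2 - C))" for x
  proof -
    have "B + 1 - (C - 1) = B + 2 - C" by simp
    then show ?thesis
      unfolding inner
      by (subst nn_integral_cmult, measurable) (simp only: nn_integral_powr_halfline[OF Mpos], simp only: mult_ac)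
  qed
  \<comment> \<open>2 * M x equals 2 rho(z) plus a sum of squares with coefficient 1, the form in
    which \<open>nn_integral_PiM_powr_shift\<close> integrates over u'.\<close>
  have Mpow: "ennreal (M x powr (B + 2 - C))
      = ennreal (2 powr (C - B - 2)) * ennreal ((2 * rho k z + (\<Sum>b\<in>other_axes k. (x b - z \<bullet> b)\<^sup>2)) powr (- (C - B - 2)))" for x
  proof -
    have "2 * rho k z + (\<Sum>b\<in>other_axes k. (x b - z \<bullet> b)\<^sup>2) = 2 * M x"
      by (simp add: M_def)
    moreover have "2 powr e * (2 * M x) powr (- e) = M x powr (- e)" for e
      using Mpos[of x] by (simp add: powr_mult powr_minus)
    moreover have "- (C - B - 2) = B + 2 - C"
      by simp
    ultimately show ?thesis
      by (metis ennreal_mult' powr_ge_zero)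
  qed
  have "(\<integral>\<^sup>+u. ennreal (rho k u powr B * cmod (rho2 k z u) powr (- C)) \<partial>volTB k)
      = (\<integral>\<^sup>+u. ennreal (rho k u powr B * cmod (rho2 k z u) powr (- C)) * indicator (TB k) u \<partial>lborel)"
    unfolding volTB_def by (subst nn_integral_restrict_space) simp_all
  also have "\<dots> = (\<integral>\<^sup>+x. \<integral>\<^sup>+t. \<integral>\<^sup>+s. ennreal (rho k (u x t s) powr B * cmod (rho2 k z (u x t s)) powr (- C))
      * indicator (TB k) (u x t s) \<partial>lborel \<partial>lborel \<partial>(\<Pi>\<^sub>M b\<in>other_axes k. lborel))"
    unfolding u_def by (rule nn_integral_lborel_coords) measurable
  also have "\<dots> = (\<integral>\<^sup>+x. ennreal (2 powr C) * kappa (C / 2) * beta2 B (C - 1) * ennreal (2 powr (C - B - 2))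
      * ennreal ((2 * rho k z + (\<Sum>b\<in>other_axes k. (x b - z \<bullet> b)\<^sup>2)) powr (- (C - B - 2))) \<partial>(\<Pi>\<^sub>M b\<in>other_axes k. lborel))"
    unfolding middle Mpow by (simp add: mult.assoc)
  also have "\<dots> = ennreal (2 powr C) * kappa (C / 2) * beta2 B (C - 1) * ennreal (2 powr (C - B - 2))
      * (ennreal ((2 * rho k z) powr (real m / 2 - (C - B - 2))) * (\<Prod>j<m. kappa (C - B - 2 - real j / 2)))"
    using rz finite_other_axes[of k]
    by (subst nn_integral_cmult)
      (measurable, simp add: nn_integral_PiM_powr_shift card_other_axes m_def del: minus_diff_eq)
  also have "\<dots> = ennreal (2 powr C * 2 powr (C - B - 2) * (2 * rho k z) powr (real m / 2 - (C - B - 2)))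
      * (kappa (C / 2) * beta2 B (C - 1) * (\<Prod>j<m. kappa (C - B - 2 - real j / 2)))"
    by (simp add: ennreal_mult' mult_ac)
  also have "2 powr C * 2 powr (C - B - 2) * (2 * rho k z) powr (real m / 2 - (C - B - 2))
      = rho k z powr (real CARD('n) + 1 + B - C) * 2 powr (C + real (CARD('n) - 1))"
  proof -
    have m: "real m / 2 = real (CARD('n) - 1)" by (simp add: m_def)
    have "real (CARD('n) - 1) = real CARD('n) - 1" by (simp add: of_nat_diff)
    then show ?thesis using rz unfolding m
      by (simp add: powr_mult powr_add [symmetric] algebra_simps)
  qed
  finally show ?thesis
    by (simp add: FR_def m_def ennreal_mult' mult_ac)
qed

section \<open>Sufficiency\<close>

lemma space_volTB [simp]: "space (volTB k) = TB k"
  by (simp add: volTB_def space_restrict_space)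

lemma space_dVa [simp]: "space (dVa k \<alpha>) = TB k"
  by (simp add: dVa_def)

lemma sets_dVa [measurable_cong, simp]: "sets (dVa k \<alpha>) = sets (volTB k)"
  by (simp add: dVa_def)

lemma measurable_volTB: "f \<in> borel \<rightarrow>\<^sub>M N \<Longrightarrow> f \<in> volTB k \<rightarrow>\<^sub>M N"
  unfolding volTB_def by (rule measurable_restrict_space1) simp

lemma rho_measurable_volTB [measurable]: "rho k \<in> borel_measurable (volTB k)"
  by (intro measurable_volTB rho_measurable)

lemma rho2_measurable_volTB [measurable]: "rho2 k z \<in> borel_measurable (volTB k)"
  by (intro measurable_volTB rho2_measurable)

lemma sigma_finite_volTB: "sigma_finite_measure (volTB k)"
  unfolding volTB_def by (rule sigma_finite_measure_restrict_space) (simp_all add: lborel.sigma_finite_measure_axioms)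

lemma pair_sigma_finite_volTB: "pair_sigma_finite (volTB k) (volTB k)"
  by (intro pair_sigma_finite.intro sigma_finite_volTB)

lemma measurable_pair_volTB:
  assumes "f \<in> borel \<rightarrow>\<^sub>M N"
  shows "f \<in> (volTB k \<Otimes>\<^sub>M volTB k) \<rightarrow>\<^sub>M N"
proof -
  have "(\<lambda>x. x) \<in> volTB k \<rightarrow>\<^sub>M borel"
    by (rule measurable_volTB) simp
  then have "(\<lambda>p. (fst p, snd p)) \<in> (volTB k \<Otimes>\<^sub>M volTB k) \<rightarrow>\<^sub>M (borel \<Otimes>\<^sub>M borel)"
    by (intro measurable_Pair) (auto intro: measurable_compose[OF measurable_fst] measurable_compose[OF measurable_snd])
  then show ?thesis
    using assms by (simp add: borel_prod measurable_compose)
qed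

lemma continuous_on_TB_measurable:
  fixes f :: "(complex^'n::finite) \<times> (complex^'n) \<Rightarrow> complex"
  assumes "continuous_on (TB k \<times> TB k) f"
  shows "f \<in> borel_measurable (volTB k \<Otimes>\<^sub>M volTB k)"
proof -
  have "TB k \<times> TB k \<in> sets (borel :: ((complex^'n) \<times> (complex^'n)) measure)"
    by (intro borel_open open_Times open_TB)
  then have "(\<lambda>x. indicator (TB k \<times> TB k) x *\<^sub>R f x) \<in> borel_measurable borel"
    using assms by (rule borel_measurable_continuous_on_indicator)
  then have "(\<lambda>x. indicator (TB k \<times> TB k) x *\<^sub>R f x) \<in> borel_measurable (volTB k \<Otimes>\<^sub>M volTB k)"
    by (rule measurable_pair_volTB)
  then show ?thesis
    by (rule measurable_cong[THEN iffD1, rotated]) (auto simp: space_pair_measure)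
qed

text \<open>Young's inequality for h/N and g/G, integrated; the two terms add up to G * N * (1/p +
  1/q). Upper bounds G and N in place of the norms avoid roots of extended reals.\<close>

lemma nn_integral_Hoelder:
  fixes g h :: "'a \<Rightarrow> real"
  assumes p: "1 < p" and q: "1 < q" and pq: "1/p + 1/q = 1"
    and [measurable]: "g \<in> borel_measurable M" "h \<in> borel_measurable M"
    and nonneg: "\<And>x. x \<in> space M \<Longrightarrow> 0 \<le> g x" "\<And>x. x \<in> space M \<Longrightarrow> 0 \<le> h x"
    and G: "0 < G" "(\<integral>\<^sup>+x. ennreal (g x powr q) \<partial>M) \<le> ennreal (G powr q)"
    and N: "0 < N" "(\<integral>\<^sup>+x. ennreal (h x powr p) \<partial>M) \<le> ennreal (N powr p)"
  shows "(\<integral>\<^sup>+x. ennreal (g x * h x) \<partial>M) \<le> ennreal (G * N)"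
proof -
  have "(\<integral>\<^sup>+x. ennreal (g x * h x) \<partial>M)
     \<le> (\<integral>\<^sup>+x. ennreal (G * N / q / G powr q) * ennreal (g x powr q) + ennreal (G * N / p / N powr p) * ennreal (h x powr p) \<partial>M)"
  proof (rule nn_integral_mono)
    fix x assume x: "x \<in> space M"
    have "(h x / N) * (g x / G) \<le> (h x / N) powr p / p + (g x / G) powr q / q"
      using p q pq nonneg[OF x] G N by (intro Youngs_inequality) auto
    then have "G * N * ((h x / N) * (g x / G)) \<le> G * N * ((h x / N) powr p / p + (g x / G) powr q / q)"
      using G N by (intro mult_left_mono) auto
    also have "G * N * ((h x / N) * (g x / G)) = g x * h x"
      using G N by simp
    also have "G * N * ((h x / N) powr p / p + (g x / G) powr q / q)
       = G * N / q / G powr q * g x powr q + G * N / p / N powr p * h x powr p"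
      using G N nonneg[OF x] by (simp add: powr_divide algebra_simps)
    finally show "ennreal (g x * h x) \<le> ennreal (G * N / q / G powr q) * ennreal (g x powr q) + ennreal (G * N / p / N powr p) * ennreal (h x powr p)"
      using p q G N by (simp add: ennreal_mult'[symmetric] ennreal_plus[symmetric] ennreal_leI del: ennreal_plus)
  qed
  also have "\<dots> = ennreal (G * N / q / G powr q) * (\<integral>\<^sup>+x. ennreal (g x powr q) \<partial>M)
      + ennreal (G * N / p / N powr p) * (\<integral>\<^sup>+x. ennreal (h x powr p) \<partial>M)"
    by (simp add: nn_integral_add nn_integral_cmult)
  also have "\<dots> \<le> ennreal (G * N / q / G powr q) * ennreal (G powr q) + ennreal (G * N / p / N powr p) * ennreal (N powr p)"
    by (intro add_mono mult_left_mono G N) auto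
  also have "\<dots> = ennreal (G * N / q + G * N / p)"
    using p q G N by (simp add: ennreal_mult'[symmetric] ennreal_plus[symmetric] del: ennreal_plus)
  also have "G * N / q + G * N / p = G * N * (1/p + 1/q)"
    by (simp add: algebra_simps)
  finally show ?thesis by (simp add: pq)
qed

section \<open>Roots, the weighted measure, and one factor of the kernel\<close>

lemma enn_root_le_iff:
  assumes "0 < p" "0 \<le> N"
  shows "enn_root p x \<le> ennreal N \<longleftrightarrow> x \<le> ennreal (N powr p)"
proof (cases x)
  case (real r)
  have "r powr (1/p) \<le> N \<longleftrightarrow> r \<le> N powr p"
  proof
    assume "r powr (1/p) \<le> N"
    then have "(r powr (1/p)) powr p \<le> N powr p"
      using assms by (intro powr_mono2) auto
    then show "r \<le> N powr p" using assms real by (simp add: powr_powr)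
  next
    assume "r \<le> N powr p"
    then have "r powr (1/p) \<le> (N powr p) powr (1/p)"
      using assms real by (intro powr_mono2) auto
    then show "r powr (1/p) \<le> N" using assms by (simp add: powr_powr)
  qed
  then show ?thesis
    using real assms by (simp add: enn_root_def ennreal_le_iff)
qed (simp add: enn_root_def top_unique)

lemma enn_root_measurable [measurable]: "enn_root p \<in> borel_measurable borel"
  unfolding enn_root_def by measurable

lemma nn_integral_dVa:
  assumes [measurable]: "f \<in> borel_measurable (volTB k)"
  shows "(\<integral>\<^sup>+z. f z \<partial>dVa k \<alpha>) = (\<integral>\<^sup>+z. ennreal (rho k z powr \<alpha>) * f z \<partial>volTB k)"
  unfolding dVa_def by (subst nn_integral_density) auto

text \<open>The weight is positive throughout \<open>TB k\<close>, so the two measures have the same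
  null sets.\<close>

lemma AE_dVa: "(AE z in dVa k \<alpha>. P z) \<longleftrightarrow> (AE z in volTB k. P z)"
proof -
  have "(AE z in dVa k \<alpha>. P z) \<longleftrightarrow> (AE z in volTB k. 0 < ennreal (rho k z powr \<alpha>) \<longrightarrow> P z)"
    unfolding dVa_def by (subst AE_density) auto
  also have "\<dots> \<longleftrightarrow> (AE z in volTB k. P z)"
    by (intro AE_cong) (auto simp: TB_def)
  finally show ?thesis .
qed

definition kmod :: "'n::finite \<Rightarrow> real \<Rightarrow> real \<Rightarrow> real \<Rightarrow> complex^'n \<Rightarrow> complex^'n \<Rightarrow> real" where
  "kmod k a b c z u = rho k z powr a * rho k u powr b * cmod (rho2 k z u) powr (- c)"

lemma kmod_nonneg [simp]: "0 \<le> kmod k a b c z u"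
  by (simp add: kmod_def)

lemma kmod_measurable [measurable]: "kmod k a b c z \<in> borel_measurable (volTB k)"
  unfolding kmod_def by measurable

lemma nn_integral_kmod:
  fixes k :: "'n::finite"
  assumes "z \<in> TB k"
  shows "(\<integral>\<^sup>+u. ennreal (kmod k a b c z u) \<partial>volTB k)
     = ennreal (rho k z powr (real CARD('n) + 1 + a + b - c)) * FR CARD('n) b c"
proof -
  have "(\<integral>\<^sup>+u. ennreal (kmod k a b c z u) \<partial>volTB k)
      = (\<integral>\<^sup>+u. ennreal (rho k z powr a) * ennreal (rho k u powr b * cmod (rho2 k z u) powr (- c)) \<partial>volTB k)"
    by (simp add: kmod_def ennreal_mult' mult.assoc)
  also have "\<dots> = ennreal (rho k z powr a) * (ennreal (rho k z powr (real CARD('n) + 1 + b - c)) * FR CARD('n) b c)"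
    by (subst nn_integral_cmult) (auto simp: nn_integral_rho_powr[OF assms])
  also have "\<dots> = ennreal (rho k z powr a * rho k z powr (real CARD('n) + 1 + b - c)) * FR CARD('n) b c"
    by (simp add: ennreal_mult' mult.assoc)
  finally show ?thesis
    by (simp add: powr_add [symmetric] algebra_simps)
qed

text \<open>The q-th power of the kernel factor times the weight is again of the form
  \<open>kmod\<close>. The exponent b - \<alpha> appears because the pairing is taken with respect
  to \<open>dVa k \<alpha>\<close>, which supplies the missing rho(u)^\<alpha>.\<close>

lemma nn_integral_dVa_kmod_powr:
  fixes k :: "'n::finite"
  assumes "z \<in> TB k"
  shows "(\<integral>\<^sup>+u. ennreal (kmod k a (b - \<alpha>) c z u powr q) \<partial>dVa k \<alpha>)
     = ennreal (rho k z powr (real CARD('n) + 1 + a * q + ((b - \<alpha>) * q + \<alpha>) - c * q)) * FR CARD('n) ((b - \<alpha>) * q + \<alpha>) (c * q)"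
proof -
  have "(\<integral>\<^sup>+u. ennreal (kmod k a (b - \<alpha>) c z u powr q) \<partial>dVa k \<alpha>)
     = (\<integral>\<^sup>+u. ennreal (kmod k (a * q) ((b - \<alpha>) * q + \<alpha>) (c * q) z u) \<partial>volTB k)"
    by (subst nn_integral_dVa)
      (auto simp: kmod_def powr_mult powr_powr powr_add ennreal_mult'[symmetric] mult_ac intro!: nn_integral_cong)
  then show ?thesis
    by (simp add: nn_integral_kmod[OF assms])
qed

text \<open>The choice of c makes the L^q norm of the factor independent of z, and the conditions on
  a and b make it finite; this norm is the uniform constant G.\<close>

lemma nn_integral_kmod_Hoelder:
  fixes k :: "'n::finite"
  assumes p: "1 < p" and a: "0 < a" and b: "p * (b + 1) > \<alpha> + 1"
    and c: "c = real CARD('n) + 1 + a + b - (real CARD('n) + 1 + \<alpha>) / p"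
  shows "\<exists>G>0. \<forall>z h N. z \<in> TB k \<longrightarrow> h \<in> borel_measurable (volTB k) \<longrightarrow> (\<forall>u. 0 \<le> h u) \<longrightarrow> 0 < N \<longrightarrow>
       (\<integral>\<^sup>+u. ennreal (h u powr p) \<partial>dVa k \<alpha>) \<le> ennreal (N powr p)
       \<longrightarrow> (\<integral>\<^sup>+u. ennreal (kmod k a b c z u * h u) \<partial>volTB k) \<le> ennreal (G * N)"
proof -
  define q where "q = p / (p - 1)"
  have q: "1 < q" and pq: "1/p + 1/q = 1"
    using p by (auto simp: q_def field_simps)
  define B where "B = (b - \<alpha>) * q + \<alpha>"
  define F where "F = enn2real (FR CARD('n) B (c * q))"
  have qq: "q * (p - 1) = p" using p by (simp add: q_def)
  \<comment> \<open>Multiplying by p - 1 clears the denominator of q and turns the hypothesis on b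
    into B > -1.\<close>
  have "(B + 1) * (p - 1) = p * (b + 1) - (\<alpha> + 1)"
    unfolding B_def using qq by (simp add: algebra_simps)
  then have B: "-1 < B"
    using b p by (smt (verit) mult_less_0_iff mult_nonneg_nonneg zero_less_mult_iff)
  have e: "real CARD('n) + 1 + a * q + B - c * q = 0"
  proof -
    have "c * p = (real CARD('n) + 1 + a + b) * p - (real CARD('n) + 1 + \<alpha>)"
      unfolding c using p by (simp add: field_simps)
    then have "(real CARD('n) + 1 + a * q + B - c * q) * (p - 1) = 0"
      unfolding B_def using qq by algebra
    then show ?thesis using p by simp
  qed
  have "FR CARD('n) B (c * q) < \<infinity>"
  proof (subst FR_finite_iff)
    \<comment> \<open>As the exponent of rho(z) is zero, c * q exceeds n + 1 + B by exactly a *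
      q.\<close>
    have "0 < a * q" using a q by simp
    then show "-1 < B \<and> real CARD('n) + 1 + B < c * q"
      using B e by linarith
  qed simp
  then have F: "FR CARD('n) B (c * q) = ennreal F" "0 < F"
    using FR_pos[of "CARD('n)" B "c * q"] by (auto simp: F_def enn2real_positive_iff)
  define G where "G = F powr (1/q)"
  have G: "0 < G" "G powr q = F"
    using F q by (auto simp: G_def powr_powr)
  show ?thesis
  proof (intro exI[of _ G] conjI allI impI)
    fix z :: "complex^'n" and h :: "complex^'n \<Rightarrow> real" and N :: real
    assume z: "z \<in> TB k" and [measurable]: "h \<in> borel_measurable (volTB k)" and h: "\<forall>u. 0 \<le> h u" and N: "0 < N"
      and hN: "(\<integral>\<^sup>+u. ennreal (h u powr p) \<partial>dVa k \<alpha>) \<le> ennreal (N powr p)"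
    have "(\<integral>\<^sup>+u. ennreal (kmod k a b c z u * h u) \<partial>volTB k)
        = (\<integral>\<^sup>+u. ennreal (kmod k a (b - \<alpha>) c z u * h u) \<partial>dVa k \<alpha>)"
    proof (subst nn_integral_dVa)
      show "(\<integral>\<^sup>+u. ennreal (kmod k a b c z u * h u) \<partial>volTB k)
        = (\<integral>\<^sup>+u. ennreal (rho k u powr \<alpha>) * ennreal (kmod k a (b - \<alpha>) c z u * h u) \<partial>volTB k)"
      proof (rule nn_integral_cong)
        fix u
        have "rho k u powr b = rho k u powr \<alpha> * rho k u powr (b - \<alpha>)"
          by (simp add: powr_add [symmetric])
        then show "ennreal (kmod k a b c z u * h u) = ennreal (rho k u powr \<alpha>) * ennreal (kmod k a (b - \<alpha>) c z u * h u)"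
          by (simp add: kmod_def ennreal_mult'[symmetric] mult_ac)
      qed
    qed measurable
    also have "\<dots> \<le> ennreal (G * N)"
    proof (rule nn_integral_Hoelder[OF p q pq])
      have "rho k z \<noteq> 0" using z by (simp add: TB_def)
      then show "(\<integral>\<^sup>+u. ennreal (kmod k a (b - \<alpha>) c z u powr q) \<partial>dVa k \<alpha>) \<le> ennreal (G powr q)"
        using nn_integral_dVa_kmod_powr[OF z, where a = a and b = b and \<alpha> = \<alpha> and c = c and q = q] e F G by (simp add: B_def)
    qed (use G N h hN in \<open>auto\<close>)
    finally show "(\<integral>\<^sup>+u. ennreal (kmod k a b c z u * h u) \<partial>volTB k) \<le> ennreal (G * N)" .
  qed (rule G(1))
qed

lemma mixnorm_inf_le_imp:
  assumes "0 < p" "0 \<le> N" "mixnorm_inf k p \<alpha>1 \<alpha>2 f \<le> ennreal N"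
  shows "AE w in volTB k. (\<integral>\<^sup>+z. ennreal (cmod (f (z, w)) powr p) \<partial>dVa k \<alpha>1) \<le> ennreal (N powr p)"
proof -
  have "AE w in dVa k \<alpha>2. enn_root p (\<integral>\<^sup>+z. ennreal (cmod (f (z, w)) powr p) \<partial>dVa k \<alpha>1) \<le> mixnorm_inf k p \<alpha>1 \<alpha>2 f"
    unfolding mixnorm_inf_def by (rule esssup_AE)
  then show ?thesis
    unfolding AE_dVa enn_root_le_iff[OF assms(1,2), symmetric]
    using assms(3) by (auto elim!: AE_mp intro: order_trans)
qed

text \<open>What the argument needs of S and T alike: the modulus, which decides all norms, and
  joint continuity, which gives measurability and lets an almost everywhere bound be upgraded to
  every point.\<close>

locale double_kernel =
  fixes k :: "'n::finite" and a b c :: "real \<times> real"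
    and K :: "(complex^'n) \<times> (complex^'n) \<Rightarrow> (complex^'n) \<times> (complex^'n) \<Rightarrow> complex"
  assumes continuous_kernel: "continuous_on ((TB k \<times> TB k) \<times> (TB k \<times> TB k)) (\<lambda>p. K (fst p) (snd p))"
    and cmod_kernel: "\<And>z w u \<eta>. \<lbrakk>z \<in> TB k; w \<in> TB k; u \<in> TB k; \<eta> \<in> TB k\<rbrakk> \<Longrightarrow>
      cmod (K (z, w) (u, \<eta>)) = kmod k (fst a) (fst b) (fst c) z u * kmod k (snd a) (snd b) (snd c) w \<eta>"
begin

lemma continuous_on_kernel: "zw \<in> TB k \<times> TB k \<Longrightarrow> continuous_on (TB k \<times> TB k) (K zw)"
  by (rule continuous_on_compose2[OF continuous_kernel, of _ "\<lambda>y. (zw, y)", simplified])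
     (auto intro!: continuous_intros)

lemma measurable_kernel: "zw \<in> TB k \<times> TB k \<Longrightarrow> K zw \<in> borel_measurable (volTB k \<Otimes>\<^sub>M volTB k)"
  by (intro continuous_on_TB_measurable continuous_on_kernel)

text \<open>Tonelli with u as the inner variable: the mixed norm controls the L^p norm in u for
  almost every \<eta>, so u has to be estimated first.\<close>

lemma nn_integral_kernel:
  fixes h :: "(complex^'n) \<times> (complex^'n) \<Rightarrow> real"
  assumes z: "z \<in> TB k" and w: "w \<in> TB k" and h[measurable]: "h \<in> borel_measurable (volTB k \<Otimes>\<^sub>M volTB k)"
    and nn: "\<And>x. 0 \<le> h x"
  shows "(\<integral>\<^sup>+x. ennreal (cmod (K (z, w) x) * h x) \<partial>(volTB k \<Otimes>\<^sub>M volTB k))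
    = (\<integral>\<^sup>+\<eta>. ennreal (kmod k (snd a) (snd b) (snd c) w \<eta>)
        * (\<integral>\<^sup>+u. ennreal (kmod k (fst a) (fst b) (fst c) z u * h (u, \<eta>)) \<partial>volTB k) \<partial>volTB k)"
proof -
  interpret pair_sigma_finite "volTB k" "volTB k" by (rule pair_sigma_finite_volTB)
  have [measurable]: "K (z, w) \<in> borel_measurable (volTB k \<Otimes>\<^sub>M volTB k)"
    using z w by (intro measurable_kernel) auto
  have "(\<integral>\<^sup>+x. ennreal (cmod (K (z, w) x) * h x) \<partial>(volTB k \<Otimes>\<^sub>M volTB k))
      = (\<integral>\<^sup>+\<eta>. \<integral>\<^sup>+u. ennreal (cmod (K (z, w) (u, \<eta>)) * h (u, \<eta>)) \<partial>volTB k \<partial>volTB k)"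
    by (rule nn_integral_snd[symmetric]) measurable
  also have "\<dots> = (\<integral>\<^sup>+\<eta>. \<integral>\<^sup>+u. ennreal (kmod k (snd a) (snd b) (snd c) w \<eta>)
        * ennreal (kmod k (fst a) (fst b) (fst c) z u * h (u, \<eta>)) \<partial>volTB k \<partial>volTB k)"
    using z w by (intro nn_integral_cong) (simp add: cmod_kernel ennreal_mult'[symmetric] mult_ac)
  also have "\<dots> = (\<integral>\<^sup>+\<eta>. ennreal (kmod k (snd a) (snd b) (snd c) w \<eta>)
        * (\<integral>\<^sup>+u. ennreal (kmod k (fst a) (fst b) (fst c) z u * h (u, \<eta>)) \<partial>volTB k) \<partial>volTB k)"
    by (intro nn_integral_cong nn_integral_cmult) auto
  finally show ?thesis .
qed

text \<open>For almost every \<eta> the u-integral is at most G * N by Hoelder; what remains is the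
  L^1 norm of the second factor, which is the constant F since its power of rho(w) has exponent
  zero.\<close>

lemma bounded_sufficient:
  assumes p: "1 < p" and a: "0 < fst a" "0 < snd a"
    and b: "p * (fst b + 1) > \<alpha>1 + 1" "-1 < snd b"
    and c: "fst c = real CARD('n) + 1 + fst a + fst b - (real CARD('n) + 1 + \<alpha>1) / p"
      "snd c = real CARD('n) + 1 + snd a + snd b"
  shows "bounded_to_Linf k p \<alpha>1 \<alpha>2 K"
proof -
  obtain G where G: "0 < G" and Hoelder:
    "\<forall>z h N. z \<in> TB k \<longrightarrow> h \<in> borel_measurable (volTB k) \<longrightarrow> (\<forall>u. 0 \<le> h u) \<longrightarrow> 0 < N \<longrightarrow>
       (\<integral>\<^sup>+u. ennreal (h u powr p) \<partial>dVa k \<alpha>1) \<le> ennreal (N powr p)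
       \<longrightarrow> (\<integral>\<^sup>+u. ennreal (kmod k (fst a) (fst b) (fst c) z u * h u) \<partial>volTB k) \<le> ennreal (G * N)"
    using nn_integral_kmod_Hoelder[OF p a(1) b(1) c(1), of k] by (elim exE conjE)
  have "FR CARD('n) (snd b) (snd c) < \<infinity>"
    using a b c by (subst FR_finite_iff) auto
  then obtain F where F: "FR CARD('n) (snd b) (snd c) = ennreal F" "0 < F"
    using FR_pos[of "CARD('n)" "snd b" "snd c"] by (cases "FR CARD('n) (snd b) (snd c)") auto
  have fin: "(\<integral>\<^sup>+x. ennreal (cmod (K (z, w) x * f x)) \<partial>(volTB k \<Otimes>\<^sub>M volTB k)) \<le> ennreal (G * F) * mixnorm_inf k p \<alpha>1 \<alpha>2 f"
    if f: "f \<in> Lmix_inf k p \<alpha>1 \<alpha>2" and z: "z \<in> TB k" and w: "w \<in> TB k" for f z w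
  proof -
    obtain r where r: "mixnorm_inf k p \<alpha>1 \<alpha>2 f = ennreal r" "0 \<le> r"
      using f by (cases "mixnorm_inf k p \<alpha>1 \<alpha>2 f") (auto simp: Lmix_inf_def)
    have [measurable]: "f \<in> borel_measurable (volTB k \<Otimes>\<^sub>M volTB k)"
      using f by (simp add: Lmix_inf_def)
    \<comment> \<open>Hoelder's inequality was stated for positive N, while the norm r may vanish.
      Hence the bound is proved for every positive N >= r, and the excess is removed afterwards by
      an arbitrary e > 0.\<close>
    have *: "(\<integral>\<^sup>+x. ennreal (cmod (K (z, w) x * f x)) \<partial>(volTB k \<Otimes>\<^sub>M volTB k)) \<le> ennreal (G * F * N)"
      if N: "r \<le> N" "0 < N" for N
    proof -
      have "AE \<eta> in volTB k. (\<integral>\<^sup>+u. ennreal (cmod (f (u, \<eta>)) powr p) \<partial>dVa k \<alpha>1) \<le> ennreal (N powr p)"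
        using p N r by (intro mixnorm_inf_le_imp[where ?\<alpha>2.0 = \<alpha>2]) (auto intro: ennreal_leI)
      then have AE: "AE \<eta> in volTB k. (\<integral>\<^sup>+u. ennreal (kmod k (fst a) (fst b) (fst c) z u * cmod (f (u, \<eta>))) \<partial>volTB k) \<le> ennreal (G * N)"
        by (rule AE_mp) (use z N in \<open>auto intro!: Hoelder[rule_format]\<close>)
      have "(\<integral>\<^sup>+x. ennreal (cmod (K (z, w) x * f x)) \<partial>(volTB k \<Otimes>\<^sub>M volTB k))
        = (\<integral>\<^sup>+\<eta>. ennreal (kmod k (snd a) (snd b) (snd c) w \<eta>)
          * (\<integral>\<^sup>+u. ennreal (kmod k (fst a) (fst b) (fst c) z u * cmod (f (u, \<eta>))) \<partial>volTB k) \<partial>volTB k)"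
        unfolding norm_mult using z w by (intro nn_integral_kernel) auto
      also have "\<dots> \<le> (\<integral>\<^sup>+\<eta>. ennreal (kmod k (snd a) (snd b) (snd c) w \<eta>) * ennreal (G * N) \<partial>volTB k)"
      proof (rule nn_integral_mono_AE)
        show "AE \<eta> in volTB k. ennreal (kmod k (snd a) (snd b) (snd c) w \<eta>)
            * (\<integral>\<^sup>+u. ennreal (kmod k (fst a) (fst b) (fst c) z u * cmod (f (u, \<eta>))) \<partial>volTB k)
            \<le> ennreal (kmod k (snd a) (snd b) (snd c) w \<eta>) * ennreal (G * N)"
          using AE by eventually_elim (rule mult_left_mono, simp_all)
      qed
      also have "\<dots> = ennreal (G * F * N)"
      proof -
        have "real CARD('n) + 1 + snd a + snd b - snd c = 0" "rho k w \<noteq> 0"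
          using c(2) w by (simp_all add: TB_def)
        then have "(\<integral>\<^sup>+\<eta>. ennreal (kmod k (snd a) (snd b) (snd c) w \<eta>) \<partial>volTB k) = ennreal F"
          using nn_integral_kmod[OF w, of "snd a" "snd b" "snd c"] F by simp
        then have "(\<integral>\<^sup>+\<eta>. ennreal (kmod k (snd a) (snd b) (snd c) w \<eta>) * ennreal (G * N) \<partial>volTB k) = ennreal F * ennreal (G * N)"
          by (simp add: nn_integral_multc)
        also have "\<dots> = ennreal (F * (G * N))"
          using F by (intro ennreal_mult'[symmetric]) simp
        finally show ?thesis by (simp only: mult_ac)
      qed
      finally show ?thesis .
    qed
    show ?thesis
    proof (rule ennreal_le_epsilon)
      fix e :: real assume e: "0 < e"
      have "(\<integral>\<^sup>+x. ennreal (cmod (K (z, w) x * f x)) \<partial>(volTB k \<Otimes>\<^sub>M volTB k)) \<le> ennreal (G * F * (r + e / (G * F)))"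
        using e G F r by (intro *) (auto intro: add_nonneg_pos)
      also have "G * F * (r + e / (G * F)) = G * F * r + e"
        using G F by (simp add: field_simps)
      finally show "(\<integral>\<^sup>+x. ennreal (cmod (K (z, w) x * f x)) \<partial>(volTB k \<Otimes>\<^sub>M volTB k))
          \<le> ennreal (G * F) * mixnorm_inf k p \<alpha>1 \<alpha>2 f + ennreal e"
        using e G F r by (simp add: ennreal_mult' ennreal_plus)
    qed
  qed
  have int: "integrable (volTB k \<Otimes>\<^sub>M volTB k) (\<lambda>x. K zw x * f x)"
    if f: "f \<in> Lmix_inf k p \<alpha>1 \<alpha>2" and zw: "zw \<in> TB k \<times> TB k" for f zw
  proof (rule integrableI_bounded)
    show "(\<lambda>x. K zw x * f x) \<in> borel_measurable (volTB k \<Otimes>\<^sub>M volTB k)"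
      using f zw by (intro borel_measurable_times measurable_kernel) (auto simp: Lmix_inf_def)
    show "(\<integral>\<^sup>+x. ennreal (cmod (K zw x * f x)) \<partial>(volTB k \<Otimes>\<^sub>M volTB k)) < \<infinity>"
      using fin[OF f, of "fst zw" "snd zw"] zw f
      by (auto simp: Lmix_inf_def ennreal_mult_less_top intro: le_less_trans)
  qed
  show ?thesis
    unfolding bounded_to_Linf_def
  proof (intro exI[of _ "G * F"] ballI conjI AE_I2)
    fix f zw assume f: "f \<in> Lmix_inf k p \<alpha>1 \<alpha>2" and zw: "zw \<in> space (volTB k \<Otimes>\<^sub>M volTB k)"
    then have zw: "zw \<in> TB k \<times> TB k" by (simp add: space_pair_measure)
    show "integrable (volTB k \<Otimes>\<^sub>M volTB k) (\<lambda>ue. K zw ue * f ue)"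
      by (rule int[OF f zw])
    have "ennreal (cmod (intop k K f zw)) \<le> (\<integral>\<^sup>+x. ennreal (cmod (K zw x * f x)) \<partial>(volTB k \<Otimes>\<^sub>M volTB k))"
      unfolding intop_def by (rule integral_norm_bound_ennreal[OF int[OF f zw]])
    also have "\<dots> \<le> ennreal (G * F) * mixnorm_inf k p \<alpha>1 \<alpha>2 f"
      using fin[OF f, of "fst zw" "snd zw"] zw by auto
    finally show "ennreal (cmod (intop k K f zw)) \<le> ennreal (G * F) * mixnorm_inf k p \<alpha>1 \<alpha>2 f" .
  qed
qed

end

section \<open>The kernels of S and T as instances of \<open>double_kernel\<close>\<close>

lemma rho2_nonzero: "z \<in> TB k \<Longrightarrow> u \<in> TB k \<Longrightarrow> rho2 k z u \<noteq> 0"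
  using Re_rho2_pos[of z k u] by auto

lemma rho_nonzero: "z \<in> TB k \<Longrightarrow> rho k z \<noteq> 0"
  by (simp add: TB_def)

lemma kerS_double_kernel: "double_kernel k a b c (kerS k a b c)"
proof
  show "continuous_on ((TB k \<times> TB k) \<times> (TB k \<times> TB k)) (\<lambda>p. kerS k a b c (fst p) (snd p))"
    unfolding kerS_def case_prod_beta
    by (intro continuous_intros) (auto simp: rho2_nonzero rho_nonzero)
  show "cmod (kerS k a b c (z, w) (u, \<eta>)) = kmod k (fst a) (fst b) (fst c) z u * kmod k (snd a) (snd b) (snd c) w \<eta>" for z w u \<eta>
  proof -
    have "cmod (kerS k a b c (z, w) (u, \<eta>)) = rho k z powr fst a * rho k w powr snd a * rho k u powr fst b * rho k \<eta> powr snd b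
       / (cmod (rho2 k z u) powr fst c * cmod (rho2 k w \<eta>) powr snd c)"
      unfolding kerS_def prod.case norm_of_real by (intro abs_of_nonneg) simp
    then show ?thesis
      by (simp add: kmod_def powr_minus divide_inverse)
  qed
qed

text \<open>\<open>rho2\<close> takes values in the open right half-plane, where the principal
  branch of the power is continuous; as the exponents are real, the modulus of the power is the
  power of the modulus.\<close>

lemma kerT_double_kernel:
  fixes k :: "'n::finite"
  shows "double_kernel k a b c (kerT k a b c)"
proof
  let ?S = "(TB k \<times> TB k) \<times> (TB k \<times> TB k)"
  have 1: "continuous_on ?S (\<lambda>p. rho2 k (fst (fst p)) (fst (snd p)) powr complex_of_real (fst c))"
    by (rule continuous_on_powr_complex) (auto intro!: continuous_intros simp: Re_rho2_pos rho2_nonzero less_imp_le)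
  have 2: "continuous_on ?S (\<lambda>p. rho2 k (snd (fst p)) (snd (snd p)) powr complex_of_real (snd c))"
    by (rule continuous_on_powr_complex) (auto intro!: continuous_intros simp: Re_rho2_pos rho2_nonzero less_imp_le)
  have 3: "continuous_on ?S (\<lambda>p. rho k (fst (fst p)) powr fst a * rho k (snd (fst p)) powr snd a
      * rho k (fst (snd p)) powr fst b * rho k (snd (snd p)) powr snd b)"
    by (intro continuous_intros) (auto simp: rho_nonzero)
  show "continuous_on ?S (\<lambda>p. kerT k a b c (fst p) (snd p))"
    unfolding kerT_def case_prod_beta
    by (rule continuous_on_divide[OF continuous_on_of_real[OF 3] continuous_on_mult[OF 1 2]]) (auto simp: rho2_nonzero)
  fix z w u \<eta> :: "complex^'n" assume "z \<in> TB k" "w \<in> TB k" "u \<in> TB k" "\<eta> \<in> TB k"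
  then have nz: "rho2 k z u \<noteq> 0" "rho2 k w \<eta> \<noteq> 0"
    by (simp_all add: rho2_nonzero)
  have "cmod (x powr complex_of_real r) = cmod x powr r" for x r
    by (simp add: norm_powr_real_powr')
  then have "cmod (kerT k a b c (z, w) (u, \<eta>)) = rho k z powr fst a * rho k w powr snd a * rho k u powr fst b * rho k \<eta> powr snd b
       / (cmod (rho2 k z u) powr fst c * cmod (rho2 k w \<eta>) powr snd c)"
    using nz by (simp add: kerT_def norm_divide norm_mult)
  then show "cmod (kerT k a b c (z, w) (u, \<eta>)) = kmod k (fst a) (fst b) (fst c) z u * kmod k (snd a) (snd b) (snd c) w \<eta>"
    by (simp add: kmod_def powr_minus divide_inverse)
qed

section \<open>Necessity\<close>

lemma emeasure_volTB: "A \<subseteq> TB k \<Longrightarrow> emeasure (volTB k) A = emeasure lborel A"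
  unfolding volTB_def by (intro emeasure_restrict_space) auto

lemma sets_volTB: "A \<in> sets borel \<Longrightarrow> A \<subseteq> TB k \<Longrightarrow> A \<in> sets (volTB k)"
  unfolding volTB_def by (auto simp: sets_restrict_space_iff)

lemma emeasure_compact_volTB:
  assumes "compact A" "A \<subseteq> TB k"
  shows "emeasure (volTB k) A < \<infinity>"
  using emeasure_compact_finite[OF assms(1)] emeasure_volTB[OF assms(2)] by simp

text \<open>A property that holds almost everywhere holds on a dense set: a product of two small
  balls cut with \<open>TB k\<close> is a product of nonempty open sets and so has positive
  measure.\<close>

lemma AE_volTB_pair_dense:
  assumes P: "AE x in volTB k \<Otimes>\<^sub>M volTB k. P x" and x0: "x0 \<in> TB k \<times> TB k" and e: "0 < e"
  obtains x where "x \<in> TB k \<times> TB k" "dist x x0 < e" "P x"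
proof -
  obtain z w where zw: "x0 = (z, w)" "z \<in> TB k" "w \<in> TB k" using x0 by auto
  define A where "A = ball z (e/2) \<inter> TB k"
  define B where "B = ball w (e/2) \<inter> TB k"
  have pos: "0 < emeasure (volTB k) (ball v (e/2) \<inter> TB k)" if "v \<in> TB k" for v
  proof -
    have "v \<in> ball v (e/2) \<inter> TB k"
      using that e by simp
    then have "ball v (e/2) \<inter> TB k \<noteq> {}"
      by blast
    moreover have "open (ball v (e/2) \<inter> TB k)"
      by (intro open_Int open_ball open_TB)
    ultimately have "\<not> negligible (ball v (e/2) \<inter> TB k)"
      by (simp add: open_not_negligible)
    then have "emeasure lborel (ball v (e/2) \<inter> TB k) \<noteq> 0"
      by (auto simp: negligible_iff_null_sets null_sets_def)
    then show ?thesis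
      by (subst emeasure_volTB) (auto simp: zero_less_iff_neq_zero)
  qed
  have sets: "A \<in> sets (volTB k)" "B \<in> sets (volTB k)"
    unfolding A_def B_def by (auto intro!: sets_volTB)
  then have "emeasure (volTB k \<Otimes>\<^sub>M volTB k) (A \<times> B) = emeasure (volTB k) A * emeasure (volTB k) B"
    by (rule sigma_finite_measure.emeasure_pair_measure_Times[OF sigma_finite_volTB])
  then have AB: "emeasure (volTB k \<Otimes>\<^sub>M volTB k) (A \<times> B) \<noteq> 0"
    using pos[of z] pos[of w] zw by (auto simp: A_def B_def)
  have "\<exists>x\<in>A \<times> B. P x"
  proof (rule ccontr)
    assume "\<not> ?thesis"
    then have "AE x in volTB k \<Otimes>\<^sub>M volTB k. x \<notin> A \<times> B"
      using P by (auto elim!: eventually_mono)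
    then have "A \<times> B \<in> null_sets (volTB k \<Otimes>\<^sub>M volTB k)"
      using sets by (subst AE_iff_null_sets) auto
    then show False using AB by auto
  qed
  then obtain u v where uv: "u \<in> A" "v \<in> B" "P (u, v)" by auto
  have "dist (u, v) x0 \<le> dist u z + dist v w"
    unfolding zw dist_Pair_Pair by (rule sqrt_sum_squares_le_sum) auto
  also have "\<dots> < e"
    using uv by (auto simp: A_def B_def dist_commute)
  finally show thesis
    using uv by (intro that[of "(u, v)"]) (auto simp: A_def B_def)
qed

lemma mixnorm_inf_leI:
  assumes p: "0 < p" and N: "0 \<le> N" and [measurable]: "f \<in> borel_measurable (volTB k \<Otimes>\<^sub>M volTB k)"
    and le: "\<And>w. w \<in> TB k \<Longrightarrow> (\<integral>\<^sup>+z. ennreal (cmod (f (z, w)) powr p) \<partial>dVa k \<alpha>1) \<le> ennreal (N powr p)"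
  shows "mixnorm_inf k p \<alpha>1 \<alpha>2 f \<le> ennreal N"
  unfolding mixnorm_inf_def
proof (rule esssup_I)
  interpret sigma_finite_measure "volTB k" by (rule sigma_finite_volTB)
  \<comment> \<open>Measurability in w, which \<open>esssup_I\<close> asks for, comes from Tonelli
    once the density of \<open>dVa\<close> is written out.\<close>
  have [measurable]: "(\<lambda>w. \<integral>\<^sup>+z. ennreal (rho k z powr \<alpha>1) * ennreal (cmod (f (z, w)) powr p) \<partial>volTB k) \<in> borel_measurable (volTB k)"
    by measurable
  have "(\<lambda>w. enn_root p (\<integral>\<^sup>+z. ennreal (rho k z powr \<alpha>1) * ennreal (cmod (f (z, w)) powr p) \<partial>volTB k)) \<in> borel_measurable (dVa k \<alpha>2)"
    by measurable
  then show "(\<lambda>w. enn_root p (\<integral>\<^sup>+z. ennreal (cmod (f (z, w)) powr p) \<partial>dVa k \<alpha>1)) \<in> borel_measurable (dVa k \<alpha>2)"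
    by (rule measurable_cong[THEN iffD1, rotated]) (auto simp: nn_integral_dVa)
qed (use le p N in \<open>auto simp: enn_root_le_iff intro!: AE_I2\<close>)

text \<open>Compact sets increasing to the tube: bounded, and at a positive distance from the
  boundary in terms of \<open>rho\<close>. The summand 1 keeps the denominator positive at j =
  0.\<close>

definition TB_exhaust :: "'n::finite \<Rightarrow> nat \<Rightarrow> (complex^'n) set" where
  "TB_exhaust k j = cball 0 (real j) \<inter> {u. 1 / (real j + 1) \<le> rho k u}"

lemma compact_TB_exhaust: "compact (TB_exhaust k j)"
  unfolding TB_exhaust_def
  by (intro compact_Int_closed compact_cball closed_Collect_le continuous_intros)

lemma TB_exhaust_subset: "TB_exhaust k j \<subseteq> TB k"
  unfolding TB_exhaust_def TB_def by (auto intro: less_le_trans[rotated])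

lemma TB_exhaust_sets [measurable]: "TB_exhaust k j \<in> sets (volTB k)"
  by (intro sets_volTB borel_compact compact_TB_exhaust TB_exhaust_subset)

lemma TB_exhaust_mono: "i \<le> j \<Longrightarrow> TB_exhaust k i \<subseteq> TB_exhaust k j"
proof -
  assume "i \<le> j"
  then have "1 / (real j + 1) \<le> 1 / (real i + 1)" "real i \<le> real j"
    by (auto intro: divide_left_mono)
  then show ?thesis
    unfolding TB_exhaust_def by (auto intro: order_trans)
qed

lemma TB_exhaust_covers:
  assumes "u \<in> TB k"
  shows "\<exists>j. u \<in> TB_exhaust k j"
proof -
  obtain j where j: "max (norm u) (1 / rho k u) \<le> real j"
    using real_arch_simple by blast
  have "0 < rho k u" using assms by (simp add: TB_def)
  moreover have "1 / rho k u \<le> real j + 1" using j by simp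
  ultimately have "1 / (real j + 1) \<le> rho k u" by (simp add: field_simps)
  then show ?thesis using j by (auto simp: TB_exhaust_def)
qed

text \<open>Monotone convergence. A bound that is uniform over the compact pieces yields both
  finiteness and the bound for the whole integral.\<close>

lemma nn_integral_TB_exhaust_le:
  assumes [measurable]: "F \<in> borel_measurable (volTB k)"
    and le: "\<And>j. (\<integral>\<^sup>+u. F u * indicator (TB_exhaust k j) u \<partial>volTB k) \<le> c"
  shows "(\<integral>\<^sup>+u. F u \<partial>volTB k) \<le> c"
proof -
  have "(\<integral>\<^sup>+u. F u \<partial>volTB k) = (\<integral>\<^sup>+u. (SUP j. F u * indicator (TB_exhaust k j) u) \<partial>volTB k)"
  proof (intro nn_integral_cong antisym)
    fix u assume "u \<in> space (volTB k)"
    then obtain j where "u \<in> TB_exhaust k j" using TB_exhaust_covers[of u k] by auto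
    then show "F u \<le> (SUP j. F u * indicator (TB_exhaust k j) u)"
      by (intro SUP_upper2[of j]) auto
  qed (auto intro!: SUP_least simp: indicator_def)
  also have "\<dots> = (SUP j. \<integral>\<^sup>+u. F u * indicator (TB_exhaust k j) u \<partial>volTB k)"
  proof (rule nn_integral_monotone_convergence_SUP)
    show "incseq (\<lambda>j u. F u * indicator (TB_exhaust k j) u)"
      using TB_exhaust_mono[of _ _ k] by (auto simp: incseq_def le_fun_def indicator_def)
  qed measurable
  also have "\<dots> \<le> c" by (intro SUP_least le)
  finally show ?thesis .
qed

lemma nn_integral_continuous_compact_finite:
  fixes \<phi> :: "complex^'n::finite \<Rightarrow> real"
  assumes "continuous_on (TB k) \<phi>" "compact A" "A \<subseteq> TB k"
  shows "(\<integral>\<^sup>+u. ennreal (\<phi> u) * indicator A u \<partial>volTB k) < \<infinity>"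
proof -
  have "compact (\<phi> ` A)"
    using assms by (intro compact_continuous_image continuous_on_subset[OF assms(1)])
  then obtain R where R: "\<And>u. u \<in> A \<Longrightarrow> \<bar>\<phi> u\<bar> \<le> R"
    by (force dest!: compact_imp_bounded simp: bounded_iff)
  have "(\<integral>\<^sup>+u. ennreal (\<phi> u) * indicator A u \<partial>volTB k) \<le> (\<integral>\<^sup>+u. ennreal R * indicator A u \<partial>volTB k)"
    using R by (intro nn_integral_mono) (auto simp: indicator_def abs_le_iff intro!: ennreal_leI)
  also have "\<dots> = ennreal R * emeasure (volTB k) A"
    using assms by (intro nn_integral_cmult_indicator sets_volTB borel_compact)
  also have "\<dots> < \<infinity>"
    using emeasure_compact_volTB[OF assms(2,3)] by (simp add: ennreal_mult_less_top)
  finally show ?thesis .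
qed

lemma continuous_on_kmod: "z \<in> TB k \<Longrightarrow> continuous_on (TB k) (kmod k a b c z)"
  unfolding kmod_def by (intro continuous_intros) (auto simp: rho2_nonzero rho_nonzero)

lemma kmod_pos: "z \<in> TB k \<Longrightarrow> u \<in> TB k \<Longrightarrow> 0 < kmod k a b c z u"
  unfolding kmod_def by (simp add: rho2_nonzero rho_nonzero)

section \<open>Testing the operator on compactly supported functions\<close>

context double_kernel
begin

text \<open>The test function carries the conjugate phase of K at x0, so the operator turns it at x0
  into the integral of |K| times the prescribed modulus. The bound, known only almost everywhere,
  reaches x0 along a sequence of good points by dominated convergence.\<close>

lemma kernel_bound_on_compact:
  assumes bd: "\<And>f. f \<in> Lmix_inf k p \<alpha>1 \<alpha>2 \<Longrightarrow>
      (AE zw in volTB k \<Otimes>\<^sub>M volTB k. ennreal (cmod (intop k K f zw)) \<le> ennreal C * mixnorm_inf k p \<alpha>1 \<alpha>2 f)"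
    and C: "0 \<le> C" and p: "0 < p" and x0: "x0 \<in> TB k \<times> TB k"
    and A: "compact A" "A \<subseteq> TB k" and B: "compact B" "B \<subseteq> TB k"
    and g: "continuous_on (TB k \<times> TB k) g" "\<And>x. 0 \<le> (g x :: real)" and N: "0 \<le> N"
    and gN: "\<And>w. w \<in> TB k \<Longrightarrow> (\<integral>\<^sup>+z. ennreal ((g (z, w) * indicator (A \<times> B) (z, w)) powr p) \<partial>dVa k \<alpha>1) \<le> ennreal (N powr p)"
  shows "(\<integral>\<^sup>+x. ennreal (cmod (K x0 x) * (g x * indicator (A \<times> B) x)) \<partial>(volTB k \<Otimes>\<^sub>M volTB k)) \<le> ennreal (C * N)"
proof -
  define V where "V = volTB k \<Otimes>\<^sub>M volTB k"
  define h where "h x = g x * indicator (A \<times> B) x" for x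
  \<comment> \<open>Where K x0 vanishes, the division by zero gives f = 0, and K x0 * f = |K x0| * h
    still holds.\<close>
  define f where "f x = cnj (K x0 x) / complex_of_real (cmod (K x0 x)) * complex_of_real (h x)" for x
  have h0: "0 \<le> h x" for x using g by (simp add: h_def)
  have AB: "A \<times> B \<in> sets V"
    unfolding V_def using A B by (intro pair_measureI sets_volTB borel_compact) auto
  have "(\<lambda>x. complex_of_real (g x)) \<in> borel_measurable V"
    unfolding V_def by (intro continuous_on_TB_measurable continuous_intros g)
  then have "(\<lambda>x. Re (complex_of_real (g x))) \<in> borel_measurable V"
    by measurable
  then have [measurable]: "h \<in> borel_measurable V"
    unfolding h_def using AB by simp
  have [measurable]: "K x \<in> borel_measurable V" if "x \<in> TB k \<times> TB k" for x
    unfolding V_def using that by (rule measurable_kernel)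
  have [measurable]: "K x0 \<in> borel_measurable V" using x0 by measurable
  have f_meas [measurable]: "f \<in> borel_measurable V"
  proof -
    have [measurable]: "cnj \<in> borel_measurable borel" "complex_of_real \<in> borel_measurable borel"
      by (intro borel_measurable_continuous_onI continuous_intros)+
    show ?thesis unfolding f_def by measurable
  qed
  have Kf: "K x0 x * f x = complex_of_real (cmod (K x0 x) * h x)" for x
  proof (cases "K x0 x = 0")
    case False
    have "K x0 x * cnj (K x0 x) = complex_of_real (cmod (K x0 x)) * complex_of_real (cmod (K x0 x))"
      by (simp add: complex_norm_square[symmetric] power2_eq_square)
    then show ?thesis using False by (simp add: f_def field_simps)
  qed (simp add: f_def)
  have f_le: "cmod (f x) \<le> h x" for x
    using h0[of x] by (cases "K x0 x = 0") (auto simp: f_def norm_mult norm_divide)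
  have norm_f: "mixnorm_inf k p \<alpha>1 \<alpha>2 f \<le> ennreal N"
  proof (rule mixnorm_inf_leI[OF p N])
    fix w assume "w \<in> TB k"
    have "(\<integral>\<^sup>+z. ennreal (cmod (f (z, w)) powr p) \<partial>dVa k \<alpha>1) \<le> (\<integral>\<^sup>+z. ennreal (h (z, w) powr p) \<partial>dVa k \<alpha>1)"
      using f_le p by (intro nn_integral_mono ennreal_leI powr_mono2) auto
    also have "\<dots> \<le> ennreal (N powr p)"
      unfolding h_def by (rule gN) fact
    finally show "(\<integral>\<^sup>+z. ennreal (cmod (f (z, w)) powr p) \<partial>dVa k \<alpha>1) \<le> ennreal (N powr p)" .
  qed (use f_meas in \<open>simp add: V_def\<close>)
  then have "f \<in> Lmix_inf k p \<alpha>1 \<alpha>2"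
    using f_meas by (auto simp: Lmix_inf_def V_def intro: le_less_trans)
  then have AE1: "AE zw in V. ennreal (cmod (intop k K f zw)) \<le> ennreal C * mixnorm_inf k p \<alpha>1 \<alpha>2 f"
    unfolding V_def by (rule bd)
  have C_f: "ennreal C * mixnorm_inf k p \<alpha>1 \<alpha>2 f \<le> ennreal (C * N)"
    using norm_f C by (simp add: ennreal_mult' mult_left_mono)
  have "0 \<le> C * N" using C N by simp
  from AE1 have AE: "AE zw in V. cmod (intop k K f zw) \<le> C * N"
  proof eventually_elim
    case (elim zw)
    from order_trans[OF this C_f] show ?case
      by (simp add: ennreal_le_iff[OF \<open>0 \<le> C * N\<close>])
  qed
  have "open (TB k \<times> TB k)" by (intro open_Times open_TB)
  then obtain e where e: "0 < e" "cball x0 e \<subseteq> TB k \<times> TB k"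
    using x0 open_contains_cball by blast
  \<comment> \<open>Points of the full-measure set that converge to x0 and stay inside the closed
    ball of radius e.\<close>
  have "\<exists>x. x \<in> TB k \<times> TB k \<and> dist x x0 < e / real (Suc i) \<and> cmod (intop k K f x) \<le> C * N" for i
  proof -
    have "0 < e / real (Suc i)" using e by simp
    then show ?thesis
      using AE_volTB_pair_dense[OF AE[unfolded V_def] x0] by metis
  qed
  then obtain X where X: "\<And>i. X i \<in> TB k \<times> TB k" "\<And>i. dist (X i) x0 < e / real (Suc i)"
      "\<And>i. cmod (intop k K f (X i)) \<le> C * N"
    by metis
  have Xe: "X i \<in> cball x0 e" for i
  proof -
    have "dist (X i) x0 < e / real (Suc i)" by (rule X)
    also have "\<dots> \<le> e / 1" using e by (intro divide_left_mono) auto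
    finally show ?thesis by (simp add: dist_commute)
  qed
  have Xlim: "X \<longlonglongrightarrow> x0"
  proof (rule metric_tendsto_imp_tendsto)
    show "(\<lambda>i. e * inverse (real (Suc i))) \<longlonglongrightarrow> 0"
      using tendsto_mult[OF tendsto_const LIMSEQ_inverse_real_of_nat, of e] by simp
    show "\<forall>\<^sub>F i in sequentially. dist (X i) x0 \<le> dist (e * inverse (real (Suc i))) 0"
      using X(2) e by (auto intro!: always_eventually less_imp_le simp: divide_inverse)
  qed
  have sub: "cball x0 e \<times> (A \<times> B) \<subseteq> (TB k \<times> TB k) \<times> (TB k \<times> TB k)"
    using e A B by blast
  \<comment> \<open>Compactness of this product gives one bound R for all points near x0; R times
    the indicator of A x B is the integrable majorant.\<close>
  have "continuous_on (cball x0 e \<times> (A \<times> B)) (\<lambda>p. K (fst p) (snd p) * complex_of_real (g (snd p)))"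
    using sub A(2) B(2) by (intro continuous_intros continuous_on_subset[OF continuous_kernel] continuous_on_compose2[OF g(1)]) auto
  then have "compact ((\<lambda>p. K (fst p) (snd p) * complex_of_real (g (snd p))) ` (cball x0 e \<times> (A \<times> B)))"
    using A B by (intro compact_continuous_image compact_Times) auto
  then obtain R where R: "\<And>x y. x \<in> cball x0 e \<Longrightarrow> y \<in> A \<times> B \<Longrightarrow> cmod (K x y * complex_of_real (g y)) \<le> R"
    by (fastforce dest!: compact_imp_bounded simp: bounded_iff)
  have dom: "cmod (K x y * f y) \<le> R * indicator (A \<times> B) y" if "x \<in> cball x0 e" for x y
  proof (cases "y \<in> A \<times> B")
    case True
    have "cmod (K x y * f y) \<le> cmod (K x y) * h y"
      using f_le[of y] by (simp add: norm_mult mult_left_mono)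
    also have "\<dots> \<le> R" using R[OF that True] True g(2)[of y] by (simp add: h_def norm_mult)
    finally show ?thesis using True by simp
  next
    case False
    then show ?thesis by (simp add: f_def h_def)
  qed
  have int_dom: "integrable V (\<lambda>y. R * indicator (A \<times> B) y)"
  proof -
    have "emeasure V (A \<times> B) < \<infinity>"
      unfolding V_def using A B emeasure_compact_volTB[of A k] emeasure_compact_volTB[of B k]
      by (subst sigma_finite_measure.emeasure_pair_measure_Times[OF sigma_finite_volTB]) (auto simp: ennreal_mult_less_top intro!: sets_volTB borel_compact)
    then show ?thesis using AB by (intro integrable_mult_right) simp
  qed
  have lim: "(\<lambda>i. K (X i) y * f y) \<longlonglongrightarrow> K x0 y * f y" if "y \<in> space V" for y
  proof (intro tendsto_mult tendsto_const)
    have y: "y \<in> TB k \<times> TB k" using that by (simp add: V_def space_pair_measure)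
    have "continuous_on (TB k \<times> TB k) (\<lambda>x. K x y)"
      by (rule continuous_on_compose2[OF continuous_kernel, of _ "\<lambda>x. (x, y)", simplified])
        (use y in \<open>auto intro!: continuous_intros\<close>)
    then show "(\<lambda>i. K (X i) y) \<longlonglongrightarrow> K x0 y"
      by (rule continuous_on_tendsto_compose[OF _ Xlim x0]) (use X in auto)
  qed
  have meas: "(\<lambda>y. K (X i) y * f y) \<in> borel_measurable V" for i
    using X(1)[of i] by measurable
  have meas0: "(\<lambda>y. K x0 y * f y) \<in> borel_measurable V"
    by measurable
  have L: "(\<lambda>i. integral\<^sup>L V (\<lambda>y. K (X i) y * f y)) \<longlonglongrightarrow> integral\<^sup>L V (\<lambda>y. K x0 y * f y)"
    by (rule integral_dominated_convergence[OF meas0 meas int_dom]) (auto intro!: AE_I2 lim dom Xe)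
  have I: "integrable V (\<lambda>y. K x0 y * f y)"
    by (rule integrable_dominated_convergence[OF meas0 meas int_dom]) (auto intro!: AE_I2 lim dom Xe)
  have "cmod (integral\<^sup>L V (\<lambda>y. K x0 y * f y)) \<le> C * N"
    using X(3) by (intro LIMSEQ_le_const2[OF tendsto_norm[OF L]]) (auto simp: intop_def V_def)
  \<comment> \<open>At x0 the integrand is a nonnegative real, so the modulus of its integral is the
    integral of the modulus.\<close>
  then have "\<bar>integral\<^sup>L V (\<lambda>y. cmod (K x0 y) * h y)\<bar> \<le> C * N"
    unfolding Kf integral_complex_of_real norm_of_real .
  moreover have "integrable V (\<lambda>y. cmod (K x0 y) * h y)"
    using I unfolding Kf by (simp only: complex_of_real_integrable_eq)
  then have "(\<integral>\<^sup>+y. ennreal (cmod (K x0 y) * h y) \<partial>V) = ennreal (integral\<^sup>L V (\<lambda>y. cmod (K x0 y) * h y))"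
    using h0 by (intro nn_integral_eq_integral) auto
  ultimately show ?thesis
    by (simp add: V_def h_def ennreal_leI)
qed

text \<open>Tested on P^(q-1) over \<open>E j\<close> in u and on the indicator of
  \<open>E l\<close> in \<eta>, the operator bound reads i_j * H_l <= C * i_j^(1/p), that is
  i_j^(1/q) * H_l <= C. The truncation keeps i_j finite, so dividing by it is legitimate; the limits
  in l and j follow.\<close>

lemma kernel_norms_bound:
  assumes bd: "\<And>f. f \<in> Lmix_inf k p \<alpha>1 \<alpha>2 \<Longrightarrow>
      (AE zw in volTB k \<Otimes>\<^sub>M volTB k. ennreal (cmod (intop k K f zw)) \<le> ennreal C * mixnorm_inf k p \<alpha>1 \<alpha>2 f)"
    and C: "0 \<le> C" and p: "1 < p" and q: "1 < q" and pq: "1/p + 1/q = 1"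
    and z: "z \<in> TB k" and w: "w \<in> TB k"
    and I0: "(\<integral>\<^sup>+u. ennreal (kmod k (fst a) (fst b - \<alpha>1) (fst c) z u powr q) \<partial>dVa k \<alpha>1) \<noteq> 0"
    and H0: "(\<integral>\<^sup>+\<eta>. ennreal (kmod k (snd a) (snd b) (snd c) w \<eta>) \<partial>volTB k) \<noteq> 0"
  obtains i h where "0 < i" "0 < h" "i powr (1/q) * h \<le> C"
    "(\<integral>\<^sup>+u. ennreal (kmod k (fst a) (fst b - \<alpha>1) (fst c) z u powr q) \<partial>dVa k \<alpha>1) = ennreal i"
    "(\<integral>\<^sup>+\<eta>. ennreal (kmod k (snd a) (snd b) (snd c) w \<eta>) \<partial>volTB k) = ennreal h"
proof -
  define P where "P = kmod k (fst a) (fst b - \<alpha>1) (fst c) z"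
  define Q where "Q = kmod k (snd a) (snd b) (snd c) w"
  define \<phi> where "\<phi> u = rho k u powr \<alpha>1 * P u powr q" for u
  define E where "E = TB_exhaust k"
  note [measurable] = TB_exhaust_sets[of k, folded E_def]
  have [measurable]: "P \<in> borel_measurable (volTB k)" "Q \<in> borel_measurable (volTB k)"
    by (simp_all add: P_def Q_def)
  have [measurable]: "\<phi> \<in> borel_measurable (volTB k)"
    unfolding \<phi>_def by measurable
  have Ppos: "0 < P u" if "u \<in> TB k" for u
    using that z by (simp add: P_def kmod_pos)
  have Pcont: "continuous_on (TB k) P"
    unfolding P_def using z by (rule continuous_on_kmod)
  have dual: "(q - 1) * p = q" 
    using p q pq by (simp add: field_simps)
  have I_eq: "(\<integral>\<^sup>+u. ennreal (P u powr q) \<partial>dVa k \<alpha>1) = (\<integral>\<^sup>+u. ennreal (\<phi> u) \<partial>volTB k)"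
    by (subst nn_integral_dVa) (auto simp: \<phi>_def ennreal_mult')
  have fin: "(\<integral>\<^sup>+u. ennreal (\<phi> u) * indicator (E j) u \<partial>volTB k) < \<infinity>" for j
    unfolding E_def
    by (intro nn_integral_continuous_compact_finite compact_TB_exhaust TB_exhaust_subset)
      (auto simp: \<phi>_def rho_nonzero less_imp_neq[OF Ppos, symmetric] intro!: continuous_intros Pcont)
  define i where "i j = enn2real (\<integral>\<^sup>+u. ennreal (\<phi> u) * indicator (E j) u \<partial>volTB k)" for j
  have i: "(\<integral>\<^sup>+u. ennreal (\<phi> u) * indicator (E j) u \<partial>volTB k) = ennreal (i j)" "0 \<le> i j" for j
    using fin[of j] by (auto simp: i_def)
  have key: "ennreal (i j) * (\<integral>\<^sup>+\<eta>. ennreal (Q \<eta>) * indicator (E l) \<eta> \<partial>volTB k) \<le> ennreal (C * i j powr (1/p))" for j l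
  proof -
    \<comment> \<open>Equality case of Hoelder: (q - 1) * p = q makes the p-th power of g equal to
      P^q, and the kernel factor, which is rho^\<alpha>1 * P, times g is \<phi>.\<close>
    define g where "g x = P (fst x) powr (q - 1)" for x :: "(complex^'n) \<times> (complex^'n)"
    have "continuous_on (TB k \<times> TB k) g"
      unfolding g_def
      by (intro continuous_intros continuous_on_compose2[OF Pcont]) (auto simp: less_imp_neq[OF Ppos, symmetric])
    moreover have "(\<integral>\<^sup>+u. ennreal ((g (u, \<eta>) * indicator (E j \<times> E l) (u, \<eta>)) powr p) \<partial>dVa k \<alpha>1)
        \<le> ennreal ((i j powr (1/p)) powr p)" for \<eta>
    proof -
      have "(\<integral>\<^sup>+u. ennreal ((g (u, \<eta>) * indicator (E j \<times> E l) (u, \<eta>)) powr p) \<partial>dVa k \<alpha>1)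
          \<le> (\<integral>\<^sup>+u. ennreal (P u powr q) * indicator (E j) u \<partial>dVa k \<alpha>1)"
        by (intro nn_integral_mono) (auto simp: g_def indicator_def powr_powr dual)
      also have "\<dots> = (\<integral>\<^sup>+u. ennreal (\<phi> u) * indicator (E j) u \<partial>volTB k)"
        by (subst nn_integral_dVa) (auto simp: \<phi>_def ennreal_mult' mult.assoc)
      finally show ?thesis
        using p i[of j] by (simp add: powr_powr)
    qed
    ultimately have "(\<integral>\<^sup>+x. ennreal (cmod (K (z, w) x) * (g x * indicator (E j \<times> E l) x)) \<partial>(volTB k \<Otimes>\<^sub>M volTB k))
        \<le> ennreal (C * i j powr (1/p))"
      using z w p C unfolding E_def
      by (intro kernel_bound_on_compact[OF bd] compact_TB_exhaust TB_exhaust_subset) (auto simp: g_def)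
    also have "(\<integral>\<^sup>+x. ennreal (cmod (K (z, w) x) * (g x * indicator (E j \<times> E l) x)) \<partial>(volTB k \<Otimes>\<^sub>M volTB k))
        = (\<integral>\<^sup>+\<eta>. ennreal (Q \<eta>) * (\<integral>\<^sup>+u. ennreal (kmod k (fst a) (fst b) (fst c) z u * (g (u, \<eta>) * indicator (E j \<times> E l) (u, \<eta>))) \<partial>volTB k) \<partial>volTB k)"
      unfolding Q_def
    proof (rule nn_integral_kernel[OF z w])
      show "(\<lambda>x. g x * indicator (E j \<times> E l) x) \<in> borel_measurable (volTB k \<Otimes>\<^sub>M volTB k)"
        unfolding g_def by measurable
    qed (simp add: g_def)
    also have "\<dots> = (\<integral>\<^sup>+\<eta>. ennreal (Q \<eta>) * indicator (E l) \<eta> * ennreal (i j) \<partial>volTB k)"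
    proof (intro nn_integral_cong)
      fix \<eta>
      have "(\<integral>\<^sup>+u. ennreal (kmod k (fst a) (fst b) (fst c) z u * (g (u, \<eta>) * indicator (E j \<times> E l) (u, \<eta>))) \<partial>volTB k)
          = (\<integral>\<^sup>+u. indicator (E l) \<eta> * (ennreal (\<phi> u) * indicator (E j) u) \<partial>volTB k)"
      proof (intro nn_integral_cong)
        fix u assume "u \<in> space (volTB k)"
        then have u: "u \<in> TB k" by simp
        have "kmod k (fst a) (fst b) (fst c) z u = rho k u powr \<alpha>1 * P u"
          by (simp add: P_def kmod_def powr_diff rho_nonzero[OF u])
        then have "kmod k (fst a) (fst b) (fst c) z u * P u powr (q - 1) = \<phi> u"
          using Ppos[OF u] by (simp add: \<phi>_def powr_mult_base mult.assoc)
        then show "ennreal (kmod k (fst a) (fst b) (fst c) z u * (g (u, \<eta>) * indicator (E j \<times> E l) (u, \<eta>)))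
            = indicator (E l) \<eta> * (ennreal (\<phi> u) * indicator (E j) u)"
          by (auto simp: g_def indicator_def)
      qed
      also have "\<dots> = indicator (E l) \<eta> * ennreal (i j)"
        by (subst nn_integral_cmult) (auto simp: i)
      finally show "ennreal (Q \<eta>) * (\<integral>\<^sup>+u. ennreal (kmod k (fst a) (fst b) (fst c) z u * (g (u, \<eta>) * indicator (E j \<times> E l) (u, \<eta>))) \<partial>volTB k)
         = ennreal (Q \<eta>) * indicator (E l) \<eta> * ennreal (i j)"
        by (simp add: mult.assoc)
    qed
    also have "\<dots> = ennreal (i j) * (\<integral>\<^sup>+\<eta>. ennreal (Q \<eta>) * indicator (E l) \<eta> \<partial>volTB k)"
      by (subst nn_integral_multc) (auto simp: mult.commute)
    finally show ?thesis .
  qed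
  have H_le: "(\<integral>\<^sup>+\<eta>. ennreal (Q \<eta>) \<partial>volTB k) \<le> ennreal (C * i j powr (- (1/q)))" if ij: "0 < i j" for j
  proof (rule nn_integral_TB_exhaust_le)
    fix l
    have e: "i j powr (1/p) / i j = i j powr (- (1/q))"
    proof -
      have "1/p - 1 = - (1/q)" using pq by simp
      then show ?thesis using ij powr_diff[of "i j" "1/p" 1] by simp
    qed
    have "(\<integral>\<^sup>+\<eta>. ennreal (Q \<eta>) * indicator (E l) \<eta> \<partial>volTB k)
        = ennreal (1 / i j) * (ennreal (i j) * (\<integral>\<^sup>+\<eta>. ennreal (Q \<eta>) * indicator (E l) \<eta> \<partial>volTB k))"
      using ij by (simp add: mult.assoc[symmetric] ennreal_mult'[symmetric])
    also have "\<dots> \<le> ennreal (1 / i j) * ennreal (C * i j powr (1/p))"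
      by (intro mult_left_mono key) auto
    also have "\<dots> = ennreal (C * i j powr (- (1/q)))"
      using ij by (simp add: ennreal_mult'[symmetric] e[symmetric])
    finally show "(\<integral>\<^sup>+\<eta>. ennreal (Q \<eta>) * indicator (TB_exhaust k l) \<eta> \<partial>volTB k) \<le> ennreal (C * i j powr (- (1/q)))"
      by (simp add: E_def)
  qed simp
  \<comment> \<open>If all truncated integrals vanished, so would the full one, against
    \<open>I0\<close>.\<close>
  have "\<exists>j. 0 < i j"
  proof (rule ccontr)
    assume "\<not> ?thesis"
    then have "i j = 0" for j using i(2)[of j] by (auto simp: not_less intro: antisym)
    then have "(\<integral>\<^sup>+u. ennreal (\<phi> u) * indicator (TB_exhaust k j) u \<partial>volTB k) \<le> 0" for j
      using i(1)[of j] by (simp only: E_def ennreal_0 order_refl)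
    then have "(\<integral>\<^sup>+u. ennreal (\<phi> u) \<partial>volTB k) \<le> 0"
      by (rule nn_integral_TB_exhaust_le[rotated]) measurable
    then show False
      using I0 unfolding P_def[symmetric] I_eq by (simp only: le_zero_eq)
  qed
  then obtain j0 where "0 < i j0" by blast
  define H where "H = (\<integral>\<^sup>+\<eta>. ennreal (Q \<eta>) \<partial>volTB k)"
  have "H < \<infinity>" "H \<noteq> 0"
    using le_less_trans[OF H_le[OF \<open>0 < i j0\<close>] ennreal_less_top] H0
    unfolding H_def Q_def infinity_ennreal_def .
  then obtain h where "H = ennreal h" "0 < h"
    by (cases H) auto
  then have h: "(\<integral>\<^sup>+\<eta>. ennreal (Q \<eta>) \<partial>volTB k) = ennreal h" "0 < h"
    by (simp_all add: H_def)
  \<comment> \<open>With h now a fixed positive number, \<open>H_le\<close> solved for i j gives a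
    bound that does not depend on j.\<close>
  have i_le: "i j \<le> (C / h) powr q" for j
  proof (cases "0 < i j")
    case True
    then have "h \<le> C * i j powr (- (1/q))"
      using H_le[OF True] h C by (simp add: ennreal_le_iff)
    then have "i j powr (1/q) \<le> C / h"
      using h True by (simp add: powr_minus field_simps)
    then have "(i j powr (1/q)) powr q \<le> (C / h) powr q"
      using q by (intro powr_mono2) auto
    then show ?thesis using True q by (simp add: powr_powr)
  qed (use i(2)[of j] in auto)
  have "(\<integral>\<^sup>+u. ennreal (\<phi> u) \<partial>volTB k) \<le> ennreal ((C / h) powr q)"
  proof (rule nn_integral_TB_exhaust_le)
    show "(\<integral>\<^sup>+u. ennreal (\<phi> u) * indicator (TB_exhaust k j) u \<partial>volTB k) \<le> ennreal ((C / h) powr q)" for j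
      using i(1)[of j] i_le[of j] by (simp only: E_def ennreal_leI)
  qed simp
  moreover define I where "I = (\<integral>\<^sup>+u. ennreal (\<phi> u) \<partial>volTB k)"
  ultimately have "I \<le> ennreal ((C / h) powr q)" "I \<noteq> 0"
    using I0 unfolding P_def[symmetric] I_eq by simp_all
  then obtain i' where "I = ennreal i'" "0 < i'" "i' \<le> (C / h) powr q"
    by (cases I) (auto simp: top_unique ennreal_le_iff)
  then have i': "(\<integral>\<^sup>+u. ennreal (\<phi> u) \<partial>volTB k) = ennreal i'" "0 < i'" "i' \<le> (C / h) powr q"
    by (simp_all add: I_def)
  have "i' powr (1/q) \<le> ((C / h) powr q) powr (1/q)"
    using i' q by (intro powr_mono2) auto
  then have "i' powr (1/q) * h \<le> C"
    using q h C by (simp add: powr_powr field_simps)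
  then show thesis
    by (rule that[OF i'(2) h(2) _ i'(1)[folded I_eq, unfolded P_def] h(1)[unfolded Q_def]])
qed

text \<open>rho takes all positive values r and s independently in z and w, so the product of the
  two norms gives a bound for r^(e1/q) * s^e2 over the whole quadrant. This forces e1 = e2 = 0, and
  finiteness of the constants gives the inequalities.\<close>

lemma bounded_necessary:
  assumes bd: "bounded_to_Linf k p \<alpha>1 \<alpha>2 K" and p: "1 < p"
  shows "0 < fst a" "0 < snd a" "p * (fst b + 1) > \<alpha>1 + 1" "-1 < snd b"
    "fst c = real CARD('n) + 1 + fst a + fst b - (real CARD('n) + 1 + \<alpha>1) / p"
    "snd c = real CARD('n) + 1 + snd a + snd b"
proof -
  define q where "q = p / (p - 1)"
  have q: "1 < q" and pq: "1/p + 1/q = 1"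
    using p by (auto simp: q_def field_simps)
  have qq: "q * (p - 1) = p" using p by (simp add: q_def)
  define B where "B = (fst b - \<alpha>1) * q + \<alpha>1"
  define e1 where "e1 = real CARD('n) + 1 + fst a * q + B - fst c * q"
  define e2 where "e2 = real CARD('n) + 1 + snd a + snd b - snd c"
  obtain C0 where C0: "\<And>f. f \<in> Lmix_inf k p \<alpha>1 \<alpha>2 \<Longrightarrow>
      (AE zw in volTB k \<Otimes>\<^sub>M volTB k. ennreal (cmod (intop k K f zw)) \<le> ennreal C0 * mixnorm_inf k p \<alpha>1 \<alpha>2 f)"
    using bd unfolding bounded_to_Linf_def by blast
  \<comment> \<open>\<open>ennreal\<close> sends negative reals to 0, so this replacement leaves the
    bound unchanged.\<close>
  define C where "C = max C0 0"
  have C: "0 \<le> C" "ennreal C = ennreal C0"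
    by (auto simp: C_def max_def ennreal_neg)
  define F1 where "F1 = FR CARD('n) B (fst c * q)"
  define F2 where "F2 = FR CARD('n) (snd b) (snd c)"
  have I_eq: "(\<integral>\<^sup>+u. ennreal (kmod k (fst a) (fst b - \<alpha>1) (fst c) z u powr q) \<partial>dVa k \<alpha>1) = ennreal (rho k z powr e1) * F1"
    if "z \<in> TB k" for z
    using nn_integral_dVa_kmod_powr[OF that, where a = "fst a" and b = "fst b" and \<alpha> = \<alpha>1 and c = "fst c" and q = q] by (simp add: e1_def B_def F1_def)
  have H_eq: "(\<integral>\<^sup>+\<eta>. ennreal (kmod k (snd a) (snd b) (snd c) w \<eta>) \<partial>volTB k) = ennreal (rho k w powr e2) * F2"
    if "w \<in> TB k" for w
    using nn_integral_kmod[OF that, of "snd a" "snd b" "snd c"] by (simp add: e2_def F2_def)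
  have key: "\<exists>i h. 0 < i \<and> 0 < h \<and> i powr (1/q) * h \<le> C \<and> ennreal (r powr e1) * F1 = ennreal i \<and> ennreal (s powr e2) * F2 = ennreal h"
    if rs: "0 < r" "0 < s" for r s
  proof -
    \<comment> \<open>Points with purely imaginary k-th coordinate and all other coordinates zero,
      so that rho is r and s.\<close>
    define z w :: "complex^'n" where "z = axis k (\<i> * complex_of_real r)" and "w = axis k (\<i> * complex_of_real s)"
    have rho: "rho k z = r" "rho k w = s"
      by (auto simp: rho_def z_def w_def axis_def)
    then have TB: "z \<in> TB k" "w \<in> TB k" using rs by (auto simp: TB_def)
    have "ennreal (r powr e1) * F1 \<noteq> 0" "ennreal (s powr e2) * F2 \<noteq> 0"
      using rs FR_pos by (auto simp: F1_def F2_def less_imp_neq[symmetric])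
    then have ne: "(\<integral>\<^sup>+u. ennreal (kmod k (fst a) (fst b - \<alpha>1) (fst c) z u powr q) \<partial>dVa k \<alpha>1) \<noteq> 0"
        "(\<integral>\<^sup>+\<eta>. ennreal (kmod k (snd a) (snd b) (snd c) w \<eta>) \<partial>volTB k) \<noteq> 0"
      unfolding I_eq[OF TB(1)] H_eq[OF TB(2)] rho .
    obtain i h where "0 < i" "0 < h" "i powr (1/q) * h \<le> C"
      "(\<integral>\<^sup>+u. ennreal (kmod k (fst a) (fst b - \<alpha>1) (fst c) z u powr q) \<partial>dVa k \<alpha>1) = ennreal i"
      "(\<integral>\<^sup>+\<eta>. ennreal (kmod k (snd a) (snd b) (snd c) w \<eta>) \<partial>volTB k) = ennreal h"
      by (rule kernel_norms_bound[OF C0[folded C(2)] C(1) p q pq TB ne])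
    then show ?thesis
      unfolding I_eq[OF TB(1)] H_eq[OF TB(2)] rho by blast
  qed
  obtain f1 f2 where f: "0 < f1" "0 < f2" "F1 = ennreal f1" "F2 = ennreal f2"
  proof -
    obtain i h where "0 < i" "0 < h" "F1 = ennreal i" "F2 = ennreal h"
      \<comment> \<open>At r = s = 1 the powers disappear and the constants themselves are seen to
        be finite.\<close>
      using key[of 1 1] by auto
    then show thesis by (rule that)
  qed
  have bound: "(r powr e1) powr (1/q) * s powr e2 * (f1 powr (1/q) * f2) \<le> C" if rs: "0 < r" "0 < s" for r s
  proof -
    obtain i h where ih: "0 < i" "0 < h" "i powr (1/q) * h \<le> C" "ennreal (r powr e1 * f1) = ennreal i" "ennreal (s powr e2 * f2) = ennreal h"
      using key[OF rs] f by (auto simp: ennreal_mult')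
    then have "i = r powr e1 * f1" "h = s powr e2 * f2"
      using f by auto
    then show ?thesis using ih(3) f by (simp add: powr_mult mult_ac)
  qed
  \<comment> \<open>For e different from 0, the point (|D| + 1)^(1/e) is sent to |D| + 1, which
    exceeds D.\<close>
  have zero: "e = 0" if "\<And>r. 0 < r \<Longrightarrow> r powr e \<le> D" for e D :: real
  proof (rule ccontr)
    assume "e \<noteq> 0"
    then have "((\<bar>D\<bar> + 1) powr (1/e)) powr e = \<bar>D\<bar> + 1"
      by (simp add: powr_powr)
    moreover have "0 < (\<bar>D\<bar> + 1) powr (1/e)" by (simp add: add_nonneg_eq_0_iff)
    ultimately show False using that[of "(\<bar>D\<bar> + 1) powr (1/e)"] by linarith
  qed
  define f where "f = f1 powr (1/q) * f2"
  have fpos: "0 < f" using f by (simp add: f_def)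
  have bound': "r powr (e1 / q) * s powr e2 \<le> C / f" if "0 < r" "0 < s" for r s
    using bound[OF that] fpos by (simp add: f_def[symmetric] powr_powr pos_le_divide_eq)
  have "e1 / q = 0"
    using bound'[of _ 1] by (intro zero[of _ "C / f"]) simp
  then have e1: "e1 = 0" using q by simp
  have e2: "e2 = 0"
    using bound'[of 1] by (intro zero[of _ "C / f"]) simp
  have F1: "-1 < B" "real CARD('n) + 1 + B < fst c * q"
    using f FR_finite_iff[of "CARD('n)" B "fst c * q"] by (auto simp: F1_def)
  have F2: "-1 < snd b" "real CARD('n) + 1 + snd b < snd c"
    using f FR_finite_iff[of "CARD('n)" "snd b" "snd c"] by (auto simp: F2_def)
  show "-1 < snd b" by (rule F2)
  show "snd c = real CARD('n) + 1 + snd a + snd b" using e2 by (simp add: e2_def)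
  then show "0 < snd a" using F2 by simp
  \<comment> \<open>With e1 = 0 the finiteness condition c1 * q > n + 1 + B says precisely a1 * q >
    0.\<close>
  have "0 < fst a * q" using e1 F1 by (simp add: e1_def)
  then show "0 < fst a" using q by (simp add: zero_less_mult_iff)
  have "(B + 1) * (p - 1) = p * (fst b + 1) - (\<alpha>1 + 1)"
  proof -
    have "(B + 1) * (p - 1) = (fst b - \<alpha>1) * (q * (p - 1)) + (\<alpha>1 + 1) * (p - 1)"
      by (simp add: B_def algebra_simps)
    also have "\<dots> = (fst b - \<alpha>1) * p + (\<alpha>1 + 1) * (p - 1)"
      by (simp only: qq)
    finally show ?thesis
      by (simp add: algebra_simps)
  qed
  moreover have "0 < (B + 1) * (p - 1)" using F1 p by simp
  ultimately show "p * (fst b + 1) > \<alpha>1 + 1" by simp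
  have "fst c * q = real CARD('n) + 1 + fst a * q + B" using e1 by (simp add: e1_def)
  then have "fst c * p = (real CARD('n) + 1 + fst a + fst b) * p - (real CARD('n) + 1 + \<alpha>1)"
    unfolding B_def using qq by algebra
  then show "fst c = real CARD('n) + 1 + fst a + fst b - (real CARD('n) + 1 + \<alpha>1) / p"
    using p by (simp add: field_simps)
qed

end

theorem theorem6p13:
  fixes k :: "'n::finite" and p1 :: real and a b c \<alpha> :: "real \<times> real"
  assumes "1 < p1"
    and "fst \<alpha> > -1" and "snd \<alpha> > -1"
  shows "(bounded_to_Linf k p1 (fst \<alpha>) (snd \<alpha>) (kerS k a b c)
            \<longleftrightarrow> bounded_to_Linf k p1 (fst \<alpha>) (snd \<alpha>) (kerT k a b c))
       \<and> (bounded_to_Linf k p1 (fst \<alpha>) (snd \<alpha>) (kerT k a b c)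
            \<longleftrightarrow> (fst a > 0 \<and> snd a > 0 \<and> p1 * (fst b + 1) > fst \<alpha> + 1 \<and> snd b > -1
                 \<and> fst c = real CARD('n) + 1 + fst a + fst b - (real CARD('n) + 1 + fst \<alpha>) / p1
                 \<and> snd c = real CARD('n) + 1 + snd a + snd b))"
proof -
  \<comment> \<open>The condition mentions only the parameters, not the kernel, so S and T are both
    equivalent to the same statement.\<close>
  have "bounded_to_Linf k p1 (fst \<alpha>) (snd \<alpha>) K
            \<longleftrightarrow> (fst a > 0 \<and> snd a > 0 \<and> p1 * (fst b + 1) > fst \<alpha> + 1 \<and> snd b > -1
                 \<and> fst c = real CARD('n) + 1 + fst a + fst b - (real CARD('n) + 1 + fst \<alpha>) / p1
                 \<and> snd c = real CARD('n) + 1 + snd a + snd b)"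
    if "double_kernel k a b c K" for K
    using double_kernel.bounded_necessary[OF that _ assms(1)]
      double_kernel.bounded_sufficient[OF that assms(1)] by blast
  from this[OF kerS_double_kernel] this[OF kerT_double_kernel] show ?thesis
    by blast
qed

end
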